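(* Suppose LTE transmits continuously, so that the medium access indicator of a Wi-Fi AP $x_i\in\Phi_W$ is $$e_i^W=\prod_{y_k\in\Phi_L}\mathbf 1_{\{G^{LW}_{k,i}/l(\|y_k-x_i\|)\le \Gamma_{ed}/P_L\}}\ \prod_{x_j\in\Phi_W\setminus\{x_i\}}\Bigl(\mathbf 1_{\{t_j^W\ge t_i^W\}}+\mathbf 1_{\{t_j^W<t_i^W\}}\mathbf 1_{\{G^W_{j,i}/l(\|x_j-x_i\|)\le \Gamma_{cs}/P_W\}}\Bigr).$$ Then the medium access probability of a typical Wi-Fi AP, i.e. the Palm probability (with respect to $\Phi_W$) that the indicator of the typical AP equals $1$, is $$p^W_{0,\mathrm{MAP}}(\lambda_W,\lambda_L)=\exp(-N^L)\,\frac{1-\exp(-N^W)}{N^W}.$$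
   Context: Wi-Fi access points (APs) form a homogeneous Poisson point process $\Phi_W=\{x_i\}$ on $\mathbb R^2$ with intensity $\lambda_W>0$; LTE base stations (eNBs) form an independent homogeneous Poisson point process $\Phi_L=\{y_k\}$ on $\mathbb R^2$ with intensity $\lambda_L>0$. Transmit powers are $P_W,P_L>0$. The path loss is $l(d)=(4\pi/\lambda_c)^2 d^{\alpha}$ with wavelength $\lambda_c>0$ and path loss exponent $\alpha>0$. $\Gamma_{cs},\Gamma_{ed}>0$ are the carrier sensing and energy detection thresholds. Each AP $x_i$ carries a back-off timer $t_i^W$ uniform on $[0,1]$. $G^W_{j,i}$ is the fading from AP $x_j$ to AP $x_i$ and $G^{LW}_{k,i}$ the fading from eNB $y_k$ to AP $x_i$; all fading variables are i.i.d. exponential with $\mathbb P(G>s)=e^{-\mu s}$, $\mu>0$. The point processes, the timers and the fading variables are all mutually independent. Define $$N^L=\lambda_L\int_{\mathbb R^2}\exp\Bigl(-\mu\tfrac{\Gamma_{ed}}{P_L}l(\|x\|)\Bigr)dx,\qquad N^W=\lambda_W\int_{\mathbb R^2}\exp\Bigl(-\mu\tfrac{\Gamma_{cs}}{P_W}l(\|x\|)\Bigr)dx.$$ *)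

theory Defs
  imports "HOL-Probability.Probability"
begin

text \<open>
  A realisation of the network. Both point processes are given by enumerations of their points
  (a homogeneous Poisson process on the plane almost surely has infinitely many), so that the marks
  can be attached to the labels: \<open>fading_W N j i\<close> is the fading from AP \<open>j\<close> to AP \<open>i\<close>, and
  \<open>fading_LW N k i\<close> the fading from eNB \<open>k\<close> to AP \<open>i\<close>.
\<close>

record network =
  ap :: "nat \<Rightarrow> real ^ 2"
  enb :: "nat \<Rightarrow> real ^ 2"
  timer :: "nat \<Rightarrow> real"
  fading_W :: "nat \<Rightarrow> nat \<Rightarrow> real"
  fading_LW :: "nat \<Rightarrow> nat \<Rightarrow> real"

definition recentre :: "real ^ 2 \<Rightarrow> network \<Rightarrow> network" where
  "recentre v N = N\<lparr>ap := (\<lambda>j. ap N j - v), enb := (\<lambda>k. enb N k - v)\<rparr>"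

text \<open>
  Points are counted with multiplicity and in \<open>ennreal\<close>, so infinitely many points in \<open>B\<close> count as
  \<open>\<infinity>\<close> (the cardinality function on sets would give \<open>0\<close>).
\<close>

definition point_count :: "(nat \<Rightarrow> real ^ 2) \<Rightarrow> (real ^ 2) set \<Rightarrow> ennreal" where
  "point_count x B = emeasure (count_space UNIV) {i. x i \<in> B}"

text \<open>
  Local finiteness is a consequence of the second conjunct: the Poisson weights add up to \<open>1\<close> over
  the finite counts. The weights are written out because \<open>poisson_pmf\<close> requires a positive rate,
  whereas \<open>B\<close> may be a null set.
\<close>

definition homogeneous_poisson_process ::
    "'a measure \<Rightarrow> real \<Rightarrow> ('a \<Rightarrow> nat \<Rightarrow> real ^ 2) \<Rightarrow> bool" where
  "homogeneous_poisson_process M lam X \<longleftrightarrow>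
     (\<forall>i. (\<lambda>\<omega>. X \<omega> i) \<in> borel_measurable M) \<and>
     (\<forall>B\<in>sets borel. bounded B \<longrightarrow>
        (\<forall>n::nat. measure M {\<omega>\<in>space M. point_count (X \<omega>) B = of_nat n} =
           exp (- (lam * measure lborel B)) * (lam * measure lborel B) ^ n / fact n)) \<and>
     (\<forall>(m::nat) B. (\<forall>i<m. B i \<in> sets borel \<and> bounded (B i)) \<and> disjoint_family_on B {..<m} \<longrightarrow>
        prob_space.indep_vars M (\<lambda>_. borel) (\<lambda>i \<omega>. point_count (X \<omega>) (B i)) {..<m})"

text \<open>
  The independent sources of randomness. Each of the two point processes, as a whole, is one source.
\<close>

datatype source = APs | ENBs | Timer nat | Fading_W nat nat | Fading_LW nat nat

fun source_events :: "'a measure \<Rightarrow> ('a \<Rightarrow> network) \<Rightarrow> source \<Rightarrow> 'a set set" where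
  "source_events M N APs = sets (vimage_algebra (space M) (\<lambda>\<omega>. ap (N \<omega>)) (Pi\<^sub>M UNIV (\<lambda>_. borel)))"
| "source_events M N ENBs = sets (vimage_algebra (space M) (\<lambda>\<omega>. enb (N \<omega>)) (Pi\<^sub>M UNIV (\<lambda>_. borel)))"
| "source_events M N (Timer i) = sets (vimage_algebra (space M) (\<lambda>\<omega>. timer (N \<omega>) i) borel)"
| "source_events M N (Fading_W j i) = sets (vimage_algebra (space M) (\<lambda>\<omega>. fading_W (N \<omega>) j i) borel)"
| "source_events M N (Fading_LW k i) = sets (vimage_algebra (space M) (\<lambda>\<omega>. fading_LW (N \<omega>) k i) borel)"

definition path_loss :: "real \<Rightarrow> real \<Rightarrow> real \<Rightarrow> real" where
  "path_loss lamC \<alpha> d = (4 * pi / lamC)\<^sup>2 * d powr \<alpha>"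

text \<open>
  The infinite products are limits of partial products. Every factor is \<open>0\<close> or \<open>1\<close>, so the partial
  products decrease, the limits exist and the order of the factors is irrelevant. The library's
  \<open>prodinf\<close> is unspecified when infinitely many factors vanish.
\<close>

definition wifi_access_indicator ::
    "real \<Rightarrow> real \<Rightarrow> real \<Rightarrow> real \<Rightarrow> real \<Rightarrow> real \<Rightarrow> network \<Rightarrow> nat \<Rightarrow> real" where
  "wifi_access_indicator lamC \<alpha> \<Gamma>cs \<Gamma>ed PW PL N i =
     lim (\<lambda>n. \<Prod>k<n. of_bool (fading_LW N k i / path_loss lamC \<alpha> (norm (enb N k - ap N i)) \<le> \<Gamma>ed / PL)) *
     lim (\<lambda>n. \<Prod>j\<in>{..<n} - {i}.
       of_bool (timer N j \<ge> timer N i) +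
       of_bool (timer N j < timer N i) *
       of_bool (fading_W N j i / path_loss lamC \<alpha> (norm (ap N j - ap N i)) \<le> \<Gamma>cs / PW))"

text \<open>
  Palm probability with respect to the APs, for a stationary AP process of intensity \<open>lam\<close>:
  \<open>1 / (lam |B|)\<close> times the expected number of APs in \<open>B\<close> from whose position the network satisfies
  \<open>A\<close>. The predicate \<open>A\<close> is applied to the recentred network and to the label of the typical AP, the
  one sitting at the origin. Under stationarity the value does not depend on the choice of the Borel
  set \<open>B\<close> with positive finite area.
\<close>

definition palm_probability ::
    "'a measure \<Rightarrow> real \<Rightarrow> ('a \<Rightarrow> network) \<Rightarrow> (real ^ 2) set \<Rightarrow> (network \<Rightarrow> nat \<Rightarrow> bool) \<Rightarrow> ennreal" where
  "palm_probability M lam N B A =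
     (\<integral>\<^sup>+\<omega>. emeasure (count_space UNIV)
               {i. ap (N \<omega>) i \<in> B \<and> A (recentre (ap (N \<omega>) i) (N \<omega>)) i} \<partial>M)
     / (ennreal lam * emeasure lborel B)"

end

theory Submission
  imports Defs "HOL-Real_Asymp.Real_Asymp"
begin

text \<open>
  Conditionally on the two point processes and on the timer \<open>t\<close> of the AP at \<open>x\<^sub>i\<close>, the access events
  of the other nodes are independent, so the access probability is
  \<open>(\<Prod>k. 1 - h\<^sub>L (y\<^sub>k - x\<^sub>i)) * (\<Prod>j. 1 - t * h\<^sub>W (x\<^sub>j - x\<^sub>i))\<close>, where \<open>h (z)\<close> is the probability that a node
  at displacement \<open>z\<close> is heard. The generating functional of the eNB process turns the first product
  into \<open>exp (- N\<^sup>L)\<close>. Mecke's formula for the AP process turns the sum over the APs in \<open>B\<close> of the second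
  product into \<open>\<lambda>\<^sub>W * |B| * exp (- t * N\<^sup>W)\<close>, and integrating over \<open>t\<close> in \<open>[0, 1]\<close> gives the claim.

  With the convention \<open>x / 0 = 0\<close> a node at distance \<open>0\<close> is never heard, so \<open>h (0) = 0\<close>. This changes no
  integral, but it makes the factor \<open>j = i\<close> equal to \<open>1\<close>, so the product may run over all \<open>j\<close>. It also makes
  Mecke's formula elementary: \<open>h (y - x)\<close> is approximated from below by functions that are constant
  in \<open>x\<close> on small cells and vanish for \<open>y\<close> in the cell of \<open>x\<close>. For those, only the independence of the
  point counts inside and outside the cell is needed.
\<close>

section \<open>Infinite products and point counts\<close>

text \<open>For factors in [0,1] the infimum is the limit of the partial products. Values in
  \<open>ennreal\<close> let it stand under nonnegative integrals, and vanishing factors need no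
  special care.\<close>

definition iprod :: "(nat \<Rightarrow> real) \<Rightarrow> ennreal" where
  "iprod g = (INF n. ennreal (\<Prod>j<n. g j))"

lemma iprod_tendsto:
  assumes "\<And>j. 0 \<le> g j" "\<And>j. g j \<le> 1"
  shows "(\<lambda>n. ennreal (\<Prod>j<n. g j)) \<longlonglongrightarrow> iprod g"
  unfolding iprod_def
proof (rule LIMSEQ_INF, rule decseq_SucI, rule ennreal_leI)
  fix n show "(\<Prod>j<Suc n. g j) \<le> (\<Prod>j<n. g j)"
    by (auto intro!: mult_right_le_one_le prod_nonneg assms)
qed

lemma iprod_le_1: "iprod g \<le> 1"
  unfolding iprod_def by (rule INF_lower2[of 0]) auto

lemma iprod_neq_top [simp]: "iprod g \<noteq> \<top>"
  using iprod_le_1[of g] by (auto simp: top_unique)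

lemma iprod_mono:
  assumes "\<And>j. 0 \<le> g j" "\<And>j. g j \<le> g' j"
  shows "iprod g \<le> iprod g'"
  unfolding iprod_def
  by (intro INF_mono' ennreal_leI prod_mono) (auto intro: assms)

lemma iprod_measurable [measurable]:
  assumes [measurable]: "\<And>j. (\<lambda>\<omega>. g \<omega> j) \<in> borel_measurable M"
  shows "(\<lambda>\<omega>. iprod (g \<omega>)) \<in> borel_measurable M"
  unfolding iprod_def by measurable

text \<open>The upper side holds because one finite partial product of \<open>g\<close> is already
  below the bound and finite products converge. The lower side is monotonicity and relies on
  \<open>le\<close>: factors 1 for \<open>j < n\<close> and 0 beyond have product 0, while their
  pointwise limit has product 1.\<close>

lemma iprod_tendsto_from_above:
  assumes g: "\<And>j. 0 \<le> g j" and le: "\<And>n j. g j \<le> G n j"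
    and lim: "\<And>j. (\<lambda>n. G n j) \<longlonglongrightarrow> g j"
  shows "(\<lambda>n. iprod (G n)) \<longlonglongrightarrow> iprod g"
proof (rule order_tendstoI)
  fix a assume "a < iprod g"
  then show "eventually (\<lambda>n. a < iprod (G n)) sequentially"
    using iprod_mono[OF g le] by (auto intro!: always_eventually elim: less_le_trans)
next
  fix a assume "iprod g < a"
  then obtain K where K: "ennreal (\<Prod>j<K. g j) < a"
    by (auto simp: iprod_def INF_less_iff)
  have "(\<lambda>n. ennreal (\<Prod>j<K. G n j)) \<longlonglongrightarrow> ennreal (\<Prod>j<K. g j)"
    by (intro tendsto_ennrealI tendsto_prod lim)
  from order_tendstoD(2)[OF this K]
  show "eventually (\<lambda>n. iprod (G n) < a) sequentially"
    by eventually_elim (auto simp: iprod_def INF_less_iff)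
qed

text \<open>As a series of indicators the count is visibly measurable and can be exchanged with the
  expectation.\<close>

lemma point_count_eq_suminf: "point_count x B = (\<Sum>i. indicator B (x i))"
proof -
  have "point_count x B = (\<integral>\<^sup>+i. indicator {i. x i \<in> B} i \<partial>count_space UNIV)"
    by (simp add: point_count_def)
  also have "\<dots> = (\<Sum>i. indicator {i. x i \<in> B} i)" by (rule nn_integral_count_space_nat)
  finally show ?thesis by (simp add: indicator_def)
qed

lemma point_count_measurable [measurable]:
  assumes [measurable]: "\<And>i. (\<lambda>\<omega>. X \<omega> i) \<in> borel_measurable M" "B \<in> sets borel"
  shows "(\<lambda>\<omega>. point_count (X \<omega>) B) \<in> borel_measurable M"
  unfolding point_count_eq_suminf by measurable

text \<open>A finite count means that only finitely many points lie in \<open>C\<close>; all other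
  factors are 1, so the partial products become constant.\<close>

lemma iprod_eq_power_point_count:
  assumes count: "point_count x C = of_nat n" and a: "0 \<le> a" "a \<le> 1"
  shows "iprod (\<lambda>j. 1 - a * indicator C (x j)) = ennreal ((1 - a) ^ n)"
proof -
  let ?J = "{j. x j \<in> C}"
  have fin: "finite ?J"
  proof (rule ccontr)
    assume "infinite ?J"
    then show False using count by (simp add: point_count_def)
  qed
  then have card: "card ?J = n"
    using count by (simp add: point_count_def emeasure_count_space_finite)
  obtain K where K: "?J \<subseteq> {..<K}" using finite_nat_bounded[OF fin] by blast
  have "(\<Prod>j<m. 1 - a * indicator C (x j)) = (1 - a) ^ n" if "m \<ge> K" for m
  proof -
    have "(\<Prod>j<m. 1 - a * indicator C (x j)) = (\<Prod>j\<in>?J. 1 - a * indicator C (x j))"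
      using K that by (intro prod.mono_neutral_right) auto
    also have "\<dots> = (1 - a) ^ n" by (simp add: card flip: card)
    finally show ?thesis .
  qed
  then have "(\<lambda>m. ennreal (\<Prod>j<m. 1 - a * indicator C (x j))) \<longlonglongrightarrow> ennreal ((1 - a) ^ n)"
    by (intro tendsto_eventually eventually_sequentiallyI[of K]) simp
  moreover have "(\<lambda>m. ennreal (\<Prod>j<m. 1 - a * indicator C (x j))) \<longlonglongrightarrow> iprod (\<lambda>j. 1 - a * indicator C (x j))"
    using a by (intro iprod_tendsto) (auto simp: indicator_def)
  ultimately show ?thesis by (rule LIMSEQ_unique[rotated])
qed

section \<open>Integrals and series used by the later sections\<close>

text \<open>Comparison on unit annuli: where the norm lies in [n, n + 1), the integrand is at most
  its value at radius n, and the annulus fits in a ball of area \<open>V * (n + 1)^2\<close>. The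
  resulting series converges because the exponential term beats every power of n.\<close>

lemma integrable_exp_minus_norm_powr:
  assumes c: "c > 0" and \<alpha>: "\<alpha> > 0"
  shows "integrable lborel (\<lambda>x :: real ^ 2. exp (- (c * norm x powr \<alpha>)))"
proof -
  define V :: real where "V = unit_ball_vol (real DIM(real ^ 2))"
  let ?b = "\<lambda>n::nat. exp (- (c * real n powr \<alpha>)) * (V * (real n + 1)^2)"
  have V: "V \<ge> 0" by (simp add: V_def)
  have ball: "emeasure lborel (ball (0 :: real ^ 2) (real n + 1)) = ennreal (V * (real n + 1)^2)" for n
    by (subst emeasure_ball) (simp_all add: V_def)
  have "(\<integral>\<^sup>+x. ennreal (exp (- (c * norm (x :: real ^ 2) powr \<alpha>))) \<partial>lborel)
      \<le> (\<integral>\<^sup>+x. (\<Sum>n. ennreal (exp (- (c * real n powr \<alpha>))) * indicator (ball 0 (real n + 1)) (x :: real ^ 2)) \<partial>lborel)"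
  proof (rule nn_integral_mono)
    fix x :: "real ^ 2"
    let ?n = "nat \<lfloor>norm x\<rfloor>"
    have n: "real ?n \<le> norm x" "norm x < real ?n + 1" using norm_ge_zero[of x] by linarith+
    have "ennreal (exp (- (c * norm x powr \<alpha>))) \<le> ennreal (exp (- (c * real ?n powr \<alpha>))) * indicator (ball 0 (real ?n + 1)) x"
      using n c \<alpha> by (auto intro!: ennreal_leI mult_left_mono powr_mono2)
    also have "\<dots> \<le> (\<Sum>n. ennreal (exp (- (c * real n powr \<alpha>))) * indicator (ball 0 (real n + 1)) x)"
      using sum_le_suminf[of "\<lambda>n. ennreal (exp (- (c * real n powr \<alpha>))) * indicator (ball 0 (real n + 1)) x" "{?n}"]
      by simp
    finally show "ennreal (exp (- (c * norm x powr \<alpha>))) \<le> \<dots>" .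
  qed
  also have "\<dots> = (\<Sum>n. ennreal (?b n))"
  proof -
    have "(\<integral>\<^sup>+x. ennreal (exp (- (c * real n powr \<alpha>))) * indicator (ball 0 (real n + 1)) (x :: real ^ 2) \<partial>lborel)
        = ennreal (?b n)" for n
      using V by (subst nn_integral_cmult_indicator) (simp_all add: ball ennreal_mult)
    moreover have "(\<lambda>x :: real ^ 2. ennreal (exp (- (c * real n powr \<alpha>))) * indicator (ball 0 (real n + 1)) x) \<in> borel_measurable lborel" for n
      by (intro borel_measurable_times_ennreal borel_measurable_const borel_measurable_indicator) simp
    ultimately show ?thesis by (simp only: nn_integral_suminf)
  qed
  also have "\<dots> < \<infinity>"
  proof -
    have "(\<lambda>n::nat. exp (- (c * real n powr \<alpha>)) * (real n + 1)^2) \<in> O(\<lambda>n. 1 / real n ^ 2)"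
      using c \<alpha> by real_asymp
    moreover have "summable (\<lambda>n. norm (1 / real n ^ 2))"
      using inverse_power_summable[of 2, where ?'a = real] by (simp add: field_simps)
    ultimately have "summable (\<lambda>n::nat. exp (- (c * real n powr \<alpha>)) * (real n + 1)^2)"
      by (rule summable_comparison_test_bigo[rotated])
    then have "summable ?b" using summable_mult[of _ V] by (simp add: mult.left_commute)
    then show ?thesis using V by (subst suminf_ennreal2) auto
  qed
  finally show ?thesis by (intro integrableI_bounded) auto
qed

lemma suminf_swap_ennreal:
  fixes f :: "nat \<Rightarrow> nat \<Rightarrow> ennreal"
  shows "(\<Sum>i. \<Sum>k. f i k) = (\<Sum>k. \<Sum>i. f i k)"
  using nn_integral_suminf[of "\<lambda>k i. f i k" "count_space UNIV"]
  by (simp add: nn_integral_count_space_nat)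

lemma homogeneous_poisson_processD:
  assumes "homogeneous_poisson_process M lam X"
  shows "\<And>i. (\<lambda>\<omega>. X \<omega> i) \<in> borel_measurable M"
    and "\<And>B n. B \<in> sets borel \<Longrightarrow> bounded B \<Longrightarrow>
        measure M {\<omega>\<in>space M. point_count (X \<omega>) B = of_nat n} =
           exp (- (lam * measure lborel B)) * (lam * measure lborel B) ^ n / fact n"
    and "\<And>m B. (\<And>i. i < m \<Longrightarrow> B i \<in> sets borel \<and> bounded (B i)) \<Longrightarrow> disjoint_family_on B {..<m} \<Longrightarrow>
        prob_space.indep_vars M (\<lambda>_. borel) (\<lambda>i \<omega>. point_count (X \<omega>) (B i)) {..<m::nat}"
  using assms unfolding homogeneous_poisson_process_def by blast+

text \<open>This average over a uniform timer produces the last factor of the access probability,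
  with \<open>NW\<close> for \<open>a\<close>.\<close>

lemma nn_integral_exp_linear:
  fixes a :: real
  assumes "a > 0"
  shows "(\<integral>\<^sup>+t. indicator {0..1} t * ennreal (exp (- (a * t))) \<partial>lborel) = ennreal ((1 - exp (- a)) / a)"
proof -
  have "(\<integral>\<^sup>+t. ennreal (exp (- (a * t))) * indicator {0..1} t \<partial>lborel) = ennreal (- exp (- (a * 1)) / a - - exp (- (a * 0)) / a)"
    using assms by (intro nn_integral_FTC_Icc) (auto intro!: derivative_eq_intros)
  then show ?thesis by (simp add: mult.commute diff_divide_distrib)
qed

lemma distr_lborel_diff: "distr lborel borel (\<lambda>y. y - v) = (lborel :: 'a :: euclidean_space measure)"
proof -
  have "(\<lambda>y. y - v) = (+) (- v)" by (simp add: fun_eq_iff)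
  then show ?thesis by (simp only: lborel_distr_plus)
qed

lemma integrable_lborel_diff:
  fixes f :: "'a :: euclidean_space \<Rightarrow> real"
  assumes "integrable lborel f"
  shows "integrable lborel (\<lambda>y. f (y - v))"
proof -
  have "integrable (distr lborel borel (\<lambda>y. y - v)) f" using assms by (simp only: distr_lborel_diff)
  then show ?thesis by (rule integrable_distr[rotated]) simp
qed

lemma integral_lborel_diff:
  fixes f :: "'a :: euclidean_space \<Rightarrow> real"
  assumes [measurable]: "f \<in> borel_measurable borel"
  shows "(\<integral>y. f (y - v) \<partial>lborel) = (\<integral>z. f z \<partial>lborel)"
  using integral_distr[of "\<lambda>y. y - v" lborel borel f] by (simp add: distr_lborel_diff)

section \<open>Generating functional and Mecke formula of a Poisson process\<close>

locale poisson_points = prob_space M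
  for M :: "'a measure" and lam :: real and X :: "'a \<Rightarrow> nat \<Rightarrow> real ^ 2" +
  assumes lam: "lam > 0" and X: "homogeneous_poisson_process M lam X"
begin

section \<open>Law of a single point count\<close>

lemmas X_measurable [measurable] = homogeneous_poisson_processD(1)[OF X]

text \<open>The Poisson weights sum to \<open>exp (- L) * exp L = 1\<close>, so the disjoint events
  that the count is n exhaust the space up to a null set.\<close>

lemma AE_point_count_finite:
  assumes [measurable]: "B \<in> sets borel" and "bounded B"
  shows "AE \<omega> in M. \<exists>n::nat. point_count (X \<omega>) B = of_nat n"
proof -
  let ?L = "lam * measure lborel B"
  let ?E = "\<lambda>n::nat. {\<omega>\<in>space M. point_count (X \<omega>) B = of_nat n}"
  have "(\<lambda>n. prob (?E n)) sums prob (\<Union>n. ?E n)"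
    by (rule finite_measure_UNION) (auto simp: disjoint_family_on_def)
  moreover have "(\<lambda>n. prob (?E n)) sums (exp (- ?L) * exp ?L)"
    using sums_mult[OF exp_converges[of ?L], of "exp (- ?L)"]
    by (simp add: homogeneous_poisson_processD(2)[OF X assms] field_simps)
  ultimately have "prob (\<Union>n. ?E n) = exp (- ?L) * exp ?L"
    by (rule sums_unique2)
  then have "prob (\<Union>n. ?E n) = 1"
    by (simp flip: exp_add)
  then have "AE \<omega> in M. \<omega> \<in> (\<Union>n. ?E n)"
    by (subst (asm) prob_eq_1) auto
  then show ?thesis by eventually_elim auto
qed

lemma nn_integral_point_count:
  assumes [measurable]: "B \<in> sets borel" "\<phi> \<in> borel_measurable borel" and "bounded B"
  defines "L \<equiv> lam * measure lborel B"
  shows "(\<integral>\<^sup>+\<omega>. \<phi> (point_count (X \<omega>) B) \<partial>M) = (\<Sum>n. \<phi> (of_nat n) * ennreal (exp (- L) * L ^ n / fact n))"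
proof -
  let ?E = "\<lambda>n::nat. {\<omega>\<in>space M. point_count (X \<omega>) B = of_nat n}"
  have "(\<integral>\<^sup>+\<omega>. \<phi> (point_count (X \<omega>) B) \<partial>M) = (\<integral>\<^sup>+\<omega>. (\<Sum>n. \<phi> (of_nat n) * indicator (?E n) \<omega>) \<partial>M)"
  proof (rule nn_integral_cong_AE)
    show "AE \<omega> in M. \<phi> (point_count (X \<omega>) B) = (\<Sum>n. \<phi> (of_nat n) * indicator (?E n) \<omega>)"
      using AE_point_count_finite[OF assms(1,3)] AE_space
    proof eventually_elim
      case (elim \<omega>)
      then obtain m where m: "point_count (X \<omega>) B = of_nat m" by blast
      have "(\<Sum>n. \<phi> (of_nat n) * indicator (?E n) \<omega>) = (\<Sum>n\<in>{m}. \<phi> (of_nat n) * indicator (?E n) \<omega>)"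
        by (rule suminf_finite) (auto simp: m)
      with elim m show ?case by simp
    qed
  qed
  also have "\<dots> = (\<Sum>n. \<phi> (of_nat n) * emeasure M (?E n))"
    by (subst nn_integral_suminf) (auto simp: nn_integral_cmult)
  finally show ?thesis
    by (simp add: emeasure_eq_measure homogeneous_poisson_processD(2)[OF X assms(1,3)] L_def)
qed

lemma expectation_point_count:
  assumes B: "B \<in> sets borel" "bounded B"
  shows "(\<integral>\<^sup>+\<omega>. point_count (X \<omega>) B \<partial>M) = ennreal lam * emeasure lborel B"
proof -
  define L where "L = lam * measure lborel B"
  have L: "L \<ge> 0" using lam by (simp add: L_def)
  \<comment> \<open>The term n = 0 of the mean vanishes and n / n! = 1 / (n - 1)!, so after an index
    shift the mean is an exponential series.\<close>
  have "(\<lambda>n. exp (- L) * L * (L ^ n / fact n)) sums (exp (- L) * L * exp L)"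
    using sums_mult[OF exp_converges[of L], of "exp (- L) * L"] by (simp add: field_simps)
  then have "(\<lambda>n. real (Suc n) * (exp (- L) * L ^ Suc n / fact (Suc n))) sums L"
    by (simp add: exp_minus field_simps del: of_nat_Suc)
  then have "(\<lambda>n. real n * (exp (- L) * L ^ n / fact n)) sums L"
    by (subst (asm) sums_Suc_iff) simp
  then have "(\<Sum>n. ennreal (real n * (exp (- L) * L ^ n / fact n))) = ennreal L"
    using L by (intro sums_unique[symmetric] sums_ennreal[THEN iffD2]) auto
  then have "(\<integral>\<^sup>+\<omega>. point_count (X \<omega>) B \<partial>M) = ennreal L"
    using L by (subst nn_integral_point_count[OF B(1) _ B(2), of "\<lambda>x. x"])
      (auto simp: L_def ennreal_mult'[symmetric] ennreal_of_nat_eq_real_of_nat)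
  also have "\<dots> = ennreal lam * emeasure lborel B"
    using lam emeasure_bounded_finite[OF B(2)]
    by (simp add: L_def ennreal_mult' emeasure_eq_ennreal_measure)
  finally show ?thesis .
qed

text \<open>Probability generating function of the Poisson law at \<open>1 - a\<close>. The exponent
  reads the \<open>ennreal\<close> count back as a natural number, which makes the power a function
  of the count defined everywhere; its value at infinity is irrelevant, as an infinite count has
  probability 0.\<close>

lemma expectation_power_point_count:
  assumes B: "B \<in> sets borel" "bounded B" and a: "0 \<le> a" "a \<le> 1"
  shows "(\<integral>\<^sup>+\<omega>. ennreal ((1 - a) ^ nat \<lfloor>enn2real (point_count (X \<omega>) B)\<rfloor>) \<partial>M) = ennreal (exp (- (lam * (a * measure lborel B))))"
proof -
  define L where "L = lam * measure lborel B"
  have L: "L \<ge> 0" using lam by (simp add: L_def)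
  have *: "(\<lambda>n. exp (- L) * (((1 - a) * L) ^ n / fact n)) sums (exp (- L) * exp ((1 - a) * L))"
    using sums_mult[OF exp_converges[of "(1 - a) * L"], of "exp (- L)"] by (simp add: field_simps)
  have "(\<lambda>n. (1 - a) ^ n * (exp (- L) * L ^ n / fact n)) sums exp (- (lam * (a * measure lborel B)))"
  proof -
    have "exp (- L) * exp ((1 - a) * L) = exp (- (lam * (a * measure lborel B)))"
      by (simp add: L_def algebra_simps flip: exp_add)
    moreover have "(\<lambda>n. exp (- L) * (((1 - a) * L) ^ n / fact n)) = (\<lambda>n. (1 - a) ^ n * (exp (- L) * L ^ n / fact n))"
      by (simp add: power_mult_distrib fun_eq_iff)
    ultimately show ?thesis using * by simp
  qed
  then have "(\<Sum>n. ennreal ((1 - a) ^ n * (exp (- L) * L ^ n / fact n))) = ennreal (exp (- (lam * (a * measure lborel B))))"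
    using L a by (intro sums_unique[symmetric] sums_ennreal[THEN iffD2]) auto
  then show ?thesis
    using L a by (subst nn_integral_point_count[OF B(1) _ B(2), of "\<lambda>c. ennreal ((1 - a) ^ nat \<lfloor>enn2real c\<rfloor>)"])
      (auto simp: L_def ennreal_mult'[symmetric])
qed

section \<open>Generating functional weighted by a point count\<close>

text \<open>For a step function on disjoint cells, the product over all points is a product over
  cells of powers of counts, and counts in disjoint sets are independent. The weight
  \<open>\<psi>\<close> serves two ends: the constant 1 leads to the generating functional, the
  identity to Mecke's formula.\<close>

lemma expectation_point_count_iprod_simple:
  fixes k :: nat
  assumes A: "A \<in> sets borel" "bounded A"
    and C: "\<And>m. m < k \<Longrightarrow> C m \<in> sets borel" "\<And>m. m < k \<Longrightarrow> bounded (C m)"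
    and disj: "disjoint_family_on C {..<k}" "\<And>m. m < k \<Longrightarrow> A \<inter> C m = {}"
    and a: "\<And>m. m < k \<Longrightarrow> 0 \<le> a m" "\<And>m. m < k \<Longrightarrow> a m \<le> 1"
    and [measurable]: "\<psi> \<in> borel_measurable borel"
  shows "(\<integral>\<^sup>+\<omega>. \<psi> (point_count (X \<omega>) A) * iprod (\<lambda>j. 1 - (\<Sum>m<k. a m * indicator (C m) (X \<omega> j))) \<partial>M)
    = (\<integral>\<^sup>+\<omega>. \<psi> (point_count (X \<omega>) A) \<partial>M) * ennreal (exp (- (lam * (\<Sum>m<k. a m * measure lborel (C m)))))"
proof -
  let ?pw = "\<lambda>m c. ennreal ((1 - a m) ^ nat \<lfloor>enn2real c\<rfloor>)"
  \<comment> \<open>\<open>A\<close> takes index 0 in front of the cells, so that the counts in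
    \<open>A\<close> and in all cells form one independent family.\<close>
  let ?D = "case_nat A C"
  let ?\<phi> = "case_nat \<psi> ?pw"
  have D: "disjoint_family_on ?D {..<Suc k}"
    using disj unfolding disjoint_family_on_def
    by (auto split: nat.splits)
  have meas: "?\<phi> i \<in> borel_measurable borel" for i
    by (cases i) auto
  have ind: "indep_vars (\<lambda>_. borel) (\<lambda>i \<omega>. ?\<phi> i (point_count (X \<omega>) (?D i))) {..<Suc k}"
  proof (rule indep_vars_compose2[where M' = "\<lambda>_. borel" and Y = ?\<phi> and X = "\<lambda>i \<omega>. point_count (X \<omega>) (?D i)"])
    show "indep_vars (\<lambda>_. borel) (\<lambda>i \<omega>. point_count (X \<omega>) (?D i)) {..<Suc k}"
      by (rule homogeneous_poisson_processD(3)[OF X]) (use A C D in \<open>auto split: nat.splits\<close>)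
  qed (rule meas)
  have "(\<integral>\<^sup>+\<omega>. \<psi> (point_count (X \<omega>) A) * iprod (\<lambda>j. 1 - (\<Sum>m<k. a m * indicator (C m) (X \<omega> j))) \<partial>M)
    = (\<integral>\<^sup>+\<omega>. \<psi> (point_count (X \<omega>) A) * (\<Prod>m<k. ?pw m (point_count (X \<omega>) (C m))) \<partial>M)"
  proof (rule nn_integral_cong_AE)
    have "AE \<omega> in M. \<forall>m\<in>{..<k}. \<exists>n::nat. point_count (X \<omega>) (C m) = of_nat n"
      using C by (intro AE_finite_allI AE_point_count_finite) auto
    then show "AE \<omega> in M. \<psi> (point_count (X \<omega>) A) * iprod (\<lambda>j. 1 - (\<Sum>m<k. a m * indicator (C m) (X \<omega> j)))
      = \<psi> (point_count (X \<omega>) A) * (\<Prod>m<k. ?pw m (point_count (X \<omega>) (C m)))"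
    proof eventually_elim
      case (elim \<omega>)
      then obtain n where n: "\<And>m. m < k \<Longrightarrow> point_count (X \<omega>) (C m) = of_nat (n m)"
        by (metis lessThan_iff)
      \<comment> \<open>A point lies in at most one cell, so at most one summand is nonzero.\<close>
      have split: "1 - (\<Sum>m<k. a m * indicator (C m) y) = (\<Prod>m<k. 1 - a m * indicator (C m) y)" for y
      proof (cases "\<exists>l<k. y \<in> C l")
        case True
        then obtain l where l: "l < k" "y \<in> C l" by blast
        then have *: "indicator (C m) y = (of_bool (m = l) :: real)" if "m < k" for m
          using disj(1) that by (auto simp: disjoint_family_on_def indicator_def)
        have "(\<Sum>m<k. a m * indicator (C m) y) = (\<Sum>m\<in>{l}. a m)"
          using l * by (intro sum.mono_neutral_cong_right) auto
        moreover have "(\<Prod>m<k. 1 - a m * indicator (C m) y) = (\<Prod>m\<in>{l}. 1 - a m)"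
          using l * by (intro prod.mono_neutral_cong_right) auto
        ultimately show ?thesis by simp
      qed auto
      have "(\<lambda>K. ennreal (\<Prod>j<K. \<Prod>m<k. 1 - a m * indicator (C m) (X \<omega> j)))
          \<longlonglongrightarrow> iprod (\<lambda>j. \<Prod>m<k. 1 - a m * indicator (C m) (X \<omega> j))"
        using a by (intro iprod_tendsto prod_nonneg prod_le_1) (auto simp: indicator_def)
      \<comment> \<open>Exchanging the two finite products lets the limit be taken cell by
        cell.\<close>
      moreover have "(\<lambda>K. ennreal (\<Prod>j<K. \<Prod>m<k. 1 - a m * indicator (C m) (X \<omega> j)))
          \<longlonglongrightarrow> ennreal (\<Prod>m<k. (1 - a m) ^ n m)"
        unfolding prod.swap[of _ "{..<k}"]
      proof (intro tendsto_ennrealI tendsto_prod)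
        fix m assume "m \<in> {..<k}"
        then have m: "m < k" by simp
        let ?p = "\<lambda>K. \<Prod>j<K. 1 - a m * indicator (C m) (X \<omega> j)"
        have "(\<lambda>K. ennreal (?p K)) \<longlonglongrightarrow> ennreal ((1 - a m) ^ n m)"
          using a[OF m] by (subst iprod_eq_power_point_count[symmetric, OF n[OF m]])
            (auto intro!: iprod_tendsto simp: indicator_def)
        then show "?p \<longlonglongrightarrow> (1 - a m) ^ n m"
          using a[OF m] by (subst (asm) tendsto_ennreal_iff)
            (auto intro!: always_eventually prod_nonneg simp: indicator_def)
      qed
      ultimately have "iprod (\<lambda>j. \<Prod>m<k. 1 - a m * indicator (C m) (X \<omega> j)) = ennreal (\<Prod>m<k. (1 - a m) ^ n m)"
        by (rule LIMSEQ_unique)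
      moreover have "(\<Prod>m<k. ?pw m (point_count (X \<omega>) (C m))) = ennreal (\<Prod>m<k. (1 - a m) ^ n m)"
        using a by (subst prod_ennreal[symmetric]) (simp_all add: n)
      ultimately show ?case
        by (simp only: split)
    qed
  qed
  also have "\<dots> = (\<integral>\<^sup>+\<omega>. (\<Prod>i<Suc k. ?\<phi> i (point_count (X \<omega>) (?D i))) \<partial>M)"
    by (simp only: prod.lessThan_Suc_shift nat.case)
  also have "\<dots> = (\<Prod>i<Suc k. \<integral>\<^sup>+\<omega>. ?\<phi> i (point_count (X \<omega>) (?D i)) \<partial>M)"
    by (rule indep_vars_nn_integral[OF _ ind]) auto
  also have "\<dots> = (\<integral>\<^sup>+\<omega>. \<psi> (point_count (X \<omega>) A) \<partial>M) * (\<Prod>m<k. ennreal (exp (- (lam * (a m * measure lborel (C m))))))"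
    by (simp only: prod.lessThan_Suc_shift nat.case)
      (intro arg_cong2[where f = "(*)"] refl prod.cong expectation_power_point_count, auto simp: C a)
  also have "(\<Prod>m<k. ennreal (exp (- (lam * (a m * measure lborel (C m)))))) = ennreal (exp (- (lam * (\<Sum>m<k. a m * measure lborel (C m)))))"
    by (simp add: prod_ennreal exp_sum[symmetric] sum_distrib_left sum_negf)
  finally show ?thesis .
qed

text \<open>Step functions below \<open>f\<close> reduce this to disjoint cells; both sides then
  pass to the limit by dominated convergence. On the left the weight itself is the bound, integrable
  by \<open>fin\<close>; on the right the bound is \<open>f\<close>.\<close>

lemma expectation_point_count_iprod:
  assumes A: "A \<in> sets borel" "bounded A"
    and f [measurable]: "f \<in> borel_measurable borel"
    and f0: "\<And>x. 0 \<le> f x" and f1: "\<And>x. f x \<le> 1" and int: "integrable lborel f"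
    and fA: "\<And>x. x \<in> A \<Longrightarrow> f x = 0"
    and \<psi> [measurable]: "\<psi> \<in> borel_measurable borel"
    and fin: "(\<integral>\<^sup>+\<omega>. \<psi> (point_count (X \<omega>) A) \<partial>M) < \<infinity>"
  shows "(\<integral>\<^sup>+\<omega>. \<psi> (point_count (X \<omega>) A) * iprod (\<lambda>j. 1 - f (X \<omega> j)) \<partial>M)
    = (\<integral>\<^sup>+\<omega>. \<psi> (point_count (X \<omega>) A) \<partial>M) * ennreal (exp (- (lam * (\<integral>x. f x \<partial>lborel))))"
proof -
  note [measurable] = A(1)
  \<comment> \<open>\<open>s n\<close> rounds \<open>f\<close> down to multiples of 1 / (n + 1)
    inside the ball of radius n, which keeps the cells bounded; \<open>C n m\<close> is the level
    set of the value \<open>a n m\<close>. Level 0 gets no cell, so the cells avoid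
    \<open>A\<close>, where \<open>f\<close> vanishes.\<close>
  define s where "s n y = real_of_int \<lfloor>real (Suc n) * f y\<rfloor> / real (Suc n) * indicator (ball 0 (real n)) y" for n y
  define C where "C n m = {y \<in> ball 0 (real n). \<lfloor>real (Suc n) * f y\<rfloor> = int (Suc m)}" for n m
  define a where "a n m = real (Suc m) / real (Suc n)" for n m :: nat
  have s_le: "s n y \<le> f y" and s_ge: "0 \<le> s n y" for n y
    using f0[of y] by (auto simp: s_def indicator_def field_simps)
  have s_lim: "(\<lambda>n. s n y) \<longlonglongrightarrow> f y" for y
  proof (rule tendsto_sandwich[where h = "\<lambda>_. f y"])
    show "eventually (\<lambda>n. f y - 1 / real (Suc n) \<le> s n y) sequentially"
    proof -
      have "eventually (\<lambda>n. norm y < real n) sequentially"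
        by real_asymp
      then show ?thesis
      proof eventually_elim
        case (elim n)
        have "real (Suc n) * f y - 1 \<le> real_of_int \<lfloor>real (Suc n) * f y\<rfloor>" by linarith
        then have "(real (Suc n) * f y - 1) / real (Suc n) \<le> real_of_int \<lfloor>real (Suc n) * f y\<rfloor> / real (Suc n)"
          by (rule divide_right_mono) simp
        moreover have "(real (Suc n) * f y - 1) / real (Suc n) = f y - 1 / real (Suc n)"
          by (simp add: diff_divide_distrib)
        ultimately show ?case using elim by (simp add: s_def)
      qed
    qed
    show "(\<lambda>n. f y - 1 / real (Suc n)) \<longlonglongrightarrow> f y" by real_asymp
  qed (auto intro: s_le always_eventually)
  have s_eq: "s n y = (\<Sum>m<Suc n. a n m * indicator (C n m) y)" for n y
  proof (cases "y \<in> ball 0 (real n) \<and> \<lfloor>real (Suc n) * f y\<rfloor> > 0")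
    case True
    define l where "l = nat (\<lfloor>real (Suc n) * f y\<rfloor> - 1)"
    have l: "\<lfloor>real (Suc n) * f y\<rfloor> = int (Suc l)" using True by (simp add: l_def)
    have "real (Suc n) * f y \<le> real (Suc n)"
      using f1[of y] by (intro mult_left_le) auto
    then have "\<lfloor>real (Suc n) * f y\<rfloor> \<le> int (Suc n)" by linarith
    then have "l < Suc n" using l by simp
    then have "(\<Sum>m<Suc n. a n m * indicator (C n m) y) = (\<Sum>m\<in>{l}. a n m)"
      using True l by (intro sum.mono_neutral_cong_right) (auto simp: C_def indicator_def)
    then show ?thesis using True l by (simp add: s_def a_def)
  next
    case False
    moreover have "0 \<le> \<lfloor>real (Suc n) * f y\<rfloor>" using f0[of y] by simp
    ultimately have "y \<notin> ball 0 (real n) \<or> \<lfloor>real (Suc n) * f y\<rfloor> = 0" by linarith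
    then have "s n y = 0"
      unfolding s_def by (metis div_0 indicator_simps(2) mult_zero_left mult_zero_right of_int_0)
    moreover have "(\<Sum>m<Suc n. a n m * indicator (C n m) y) = 0"
    proof (intro sum.neutral ballI)
      fix m
      have "y \<notin> C n m"
      proof
        assume "y \<in> C n m"
        then have "y \<in> ball 0 (real n)" "\<lfloor>real (Suc n) * f y\<rfloor> = int (Suc m)"
          unfolding C_def by blast+
        then show False using False by (metis of_nat_0_less_iff zero_less_Suc)
      qed
      then show "a n m * indicator (C n m) y = 0" by simp
    qed
    ultimately show ?thesis by simp
  qed
  have C_meas [measurable]: "C n m \<in> sets borel" for n m
    unfolding C_def mem_ball_0 by measurable
  have C_bdd: "bounded (C n m)" for n m
    by (rule bounded_subset[OF bounded_ball[of 0 "real n"]]) (auto simp: C_def)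
  have s_meas [measurable]: "s n \<in> borel_measurable borel" for n
    unfolding s_eq[abs_def] by measurable
  have s_int: "(\<integral>x. s n x \<partial>lborel) = (\<Sum>m<Suc n. a n m * measure lborel (C n m))" for n
    unfolding s_eq using emeasure_bounded_finite[OF C_bdd]
    by (subst Bochner_Integration.integral_sum) auto
  have eq: "(\<integral>\<^sup>+\<omega>. \<psi> (point_count (X \<omega>) A) * iprod (\<lambda>j. 1 - s n (X \<omega> j)) \<partial>M)
    = (\<integral>\<^sup>+\<omega>. \<psi> (point_count (X \<omega>) A) \<partial>M) * ennreal (exp (- (lam * (\<integral>x. s n x \<partial>lborel))))" for n
    unfolding s_int unfolding s_eq
  proof (rule expectation_point_count_iprod_simple)
    show "disjoint_family_on (C n) {..<Suc n}"
      by (auto simp: disjoint_family_on_def C_def)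
    show "A \<inter> C n m = {}" for m by (auto simp: C_def fA)
  qed (auto simp: a_def A C_bdd C_meas)
  have "(\<lambda>n. \<integral>\<^sup>+\<omega>. \<psi> (point_count (X \<omega>) A) * iprod (\<lambda>j. 1 - s n (X \<omega> j)) \<partial>M)
    \<longlonglongrightarrow> (\<integral>\<^sup>+\<omega>. \<psi> (point_count (X \<omega>) A) * iprod (\<lambda>j. 1 - f (X \<omega> j)) \<partial>M)"
  proof (rule nn_integral_dominated_convergence[where w = "\<lambda>\<omega>. \<psi> (point_count (X \<omega>) A)"])
    have le: "\<psi> (point_count (X \<omega>) A) * iprod (\<lambda>j. 1 - s n (X \<omega> j)) \<le> \<psi> (point_count (X \<omega>) A)" for n \<omega>
      using mult_left_mono[OF iprod_le_1] by fastforce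
    show "AE \<omega> in M. \<psi> (point_count (X \<omega>) A) * iprod (\<lambda>j. 1 - s n (X \<omega> j)) \<le> \<psi> (point_count (X \<omega>) A)" for n
      using le by simp
    have "AE \<omega> in M. \<psi> (point_count (X \<omega>) A) \<noteq> \<infinity>"
      using fin by (intro nn_integral_PInf_AE) auto
    then show "AE \<omega> in M. (\<lambda>n. \<psi> (point_count (X \<omega>) A) * iprod (\<lambda>j. 1 - s n (X \<omega> j)))
        \<longlonglongrightarrow> \<psi> (point_count (X \<omega>) A) * iprod (\<lambda>j. 1 - f (X \<omega> j))"
    proof eventually_elim
      case (elim \<omega>)
      have "(\<lambda>n. iprod (\<lambda>j. 1 - s n (X \<omega> j))) \<longlonglongrightarrow> iprod (\<lambda>j. 1 - f (X \<omega> j))"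
        by (rule iprod_tendsto_from_above) (auto intro!: tendsto_intros s_lim simp: f1 s_le)
      then show ?case using elim by (intro tendsto_mult_ennreal) (auto simp: top_unique)
    qed
  qed (use fin in auto)
  moreover have "(\<lambda>n. (\<integral>\<^sup>+\<omega>. \<psi> (point_count (X \<omega>) A) \<partial>M) * ennreal (exp (- (lam * (\<integral>x. s n x \<partial>lborel)))))
    \<longlonglongrightarrow> (\<integral>\<^sup>+\<omega>. \<psi> (point_count (X \<omega>) A) \<partial>M) * ennreal (exp (- (lam * (\<integral>x. f x \<partial>lborel))))"
  proof (intro tendsto_mult_ennreal tendsto_ennrealI tendsto_exp tendsto_minus tendsto_mult tendsto_const)
    show "(\<lambda>n. \<integral>x. s n x \<partial>lborel) \<longlonglongrightarrow> (\<integral>x. f x \<partial>lborel)"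
      by (rule integral_dominated_convergence[where w = f])
        (use s_le s_ge s_lim int in auto)
  qed (use fin in auto)
  ultimately show ?thesis
    unfolding eq by (rule LIMSEQ_unique)
qed

text \<open>An empty \<open>A\<close> with weight 1 leaves the probability generating functional of
  the process.\<close>

corollary expectation_iprod:
  assumes f: "f \<in> borel_measurable borel" "\<And>x. 0 \<le> f x" "\<And>x. f x \<le> 1" "integrable lborel f"
  shows "(\<integral>\<^sup>+\<omega>. iprod (\<lambda>j. 1 - f (X \<omega> j)) \<partial>M) = ennreal (exp (- (lam * (\<integral>x. f x \<partial>lborel))))"
  using expectation_point_count_iprod[of "{}" f "\<lambda>_. 1"] f by (simp add: emeasure_space_1)

section \<open>Mecke's formula\<close>

text \<open>Mecke's formula for kernels that depend on the base point only through its cell. Within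
  cell \<open>k\<close> the product is the same for every base point, so summing over
  \<open>i\<close> gives the count of \<open>A k\<close> times that product. Since
  \<open>g k\<close> vanishes on the cell, the weighted generating functional applies.\<close>

lemma suminf_expectation_iprod_partition:
  assumes [measurable]: "B \<in> sets borel" "idx \<in> borel \<rightarrow>\<^sub>M count_space UNIV"
    and bdd: "\<And>k::nat. bounded {x. idx x = k}"
    and g [measurable]: "\<And>k. g k \<in> borel_measurable borel"
    and g01: "\<And>k x. 0 \<le> g k x" "\<And>k x. g k x \<le> 1"
    and g0: "\<And>x. g (idx x) x = 0"
    and int: "\<And>x. integrable lborel (g (idx x))"
  shows "(\<Sum>i. \<integral>\<^sup>+\<omega>. indicator B (X \<omega> i) * iprod (\<lambda>j. 1 - g (idx (X \<omega> i)) (X \<omega> j)) \<partial>M)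
    = ennreal lam * (\<integral>\<^sup>+x. indicator B x * ennreal (exp (- (lam * (\<integral>y. g (idx x) y \<partial>lborel)))) \<partial>lborel)"
proof -
  define A where "A k = {x \<in> B. idx x = k}" for k
  have A [measurable]: "A k \<in> sets borel" for k
    unfolding A_def by measurable
  have A_bdd: "bounded (A k)" for k
    by (rule bounded_subset[OF bdd[of k]]) (auto simp: A_def)
  have split: "indicator B x * G (idx x) = (\<Sum>k. indicator (A k) x * G k)" for x and G :: "nat \<Rightarrow> ennreal"
  proof -
    have "(\<Sum>k. indicator (A k) x * G k) = (\<Sum>k\<in>{idx x}. indicator (A k) x * G k)"
      by (rule suminf_finite) (auto simp: A_def)
    then show ?thesis by (simp add: A_def indicator_def)
  qed
  have "(\<Sum>i. \<integral>\<^sup>+\<omega>. indicator B (X \<omega> i) * iprod (\<lambda>j. 1 - g (idx (X \<omega> i)) (X \<omega> j)) \<partial>M)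
    = (\<Sum>i. \<integral>\<^sup>+\<omega>. (\<Sum>k. indicator (A k) (X \<omega> i) * iprod (\<lambda>j. 1 - g k (X \<omega> j))) \<partial>M)"
    by (intro suminf_cong nn_integral_cong split[of _ "\<lambda>k. iprod (\<lambda>j. 1 - g k (X _ j))"])
  also have "\<dots> = (\<Sum>k. \<Sum>i. \<integral>\<^sup>+\<omega>. indicator (A k) (X \<omega> i) * iprod (\<lambda>j. 1 - g k (X \<omega> j)) \<partial>M)"
    by (subst suminf_swap_ennreal) (simp add: nn_integral_suminf)
  also have "\<dots> = (\<Sum>k. \<integral>\<^sup>+\<omega>. point_count (X \<omega>) (A k) * iprod (\<lambda>j. 1 - g k (X \<omega> j)) \<partial>M)"
    by (simp add: nn_integral_suminf[symmetric] point_count_eq_suminf)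
  also have "\<dots> = (\<Sum>k. ennreal lam * (emeasure lborel (A k) * ennreal (exp (- (lam * (\<integral>y. g k y \<partial>lborel))))))"
  proof (intro suminf_cong)
    fix k
    show "(\<integral>\<^sup>+\<omega>. point_count (X \<omega>) (A k) * iprod (\<lambda>j. 1 - g k (X \<omega> j)) \<partial>M)
      = ennreal lam * (emeasure lborel (A k) * ennreal (exp (- (lam * (\<integral>y. g k y \<partial>lborel)))))"
    \<comment> \<open>Integrability of \<open>g k\<close> is known only for cells that contain some
      point of the plane, so an empty \<open>A k\<close> is treated apart; both sides are 0
      there.\<close>
    proof (cases "A k = {}")
      case True
      then show ?thesis by (simp add: point_count_def)
    next
      case False
      then obtain x where x: "idx x = k" by (auto simp: A_def)
      have "ennreal lam * emeasure lborel (A k) < \<infinity>"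
        using emeasure_bounded_finite[OF A_bdd] by (simp add: ennreal_mult_less_top)
      then show ?thesis
        using expectation_point_count_iprod[OF A A_bdd g g01, of k k "\<lambda>c. c"] int[of x] g0
        unfolding expectation_point_count[OF A A_bdd] x
        by (auto simp: mult.assoc A_def)
    qed
  qed
  also have "\<dots> = ennreal lam * (\<Sum>k. \<integral>\<^sup>+x. indicator (A k) x * ennreal (exp (- (lam * (\<integral>y. g k y \<partial>lborel)))) \<partial>lborel)"
    by (simp add: nn_integral_multc)
  also have "\<dots> = ennreal lam * (\<integral>\<^sup>+x. (\<Sum>k. indicator (A k) x * ennreal (exp (- (lam * (\<integral>y. g k y \<partial>lborel))))) \<partial>lborel)"
    by (subst nn_integral_suminf) auto
  finally show ?thesis
    by (simp only: split[of _ "\<lambda>k. ennreal (exp (- (lam * (\<integral>y. g k y \<partial>lborel))))"])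
qed

text \<open>Since \<open>h\<close> vanishes at 0, the factor \<open>j = i\<close> is 1. The kernel
  is approximated from below by kernels that are constant in the base point on small cells:
  \<open>anti\<close> gives the lower bound, \<open>cont\<close> the convergence.\<close>

lemma suminf_expectation_iprod:
  fixes p :: "real \<Rightarrow> real" and h :: "real ^ 2 \<Rightarrow> real"
  assumes anti: "\<And>r r'. 0 < r \<Longrightarrow> r \<le> r' \<Longrightarrow> p r' \<le> p r"
    and cont: "continuous_on {0<..} p" and p01: "\<And>r. 0 \<le> p r" "\<And>r. p r \<le> 1"
    and h: "\<And>z. h z = (if z = 0 then 0 else p (norm z))" and int: "integrable lborel h"
    and B [measurable]: "B \<in> sets borel" and fin: "emeasure lborel B < \<infinity>"
  shows "(\<Sum>i. \<integral>\<^sup>+\<omega>. indicator B (X \<omega> i) * iprod (\<lambda>j. 1 - h (X \<omega> j - X \<omega> i)) \<partial>M)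
    = ennreal lam * (emeasure lborel B * ennreal (exp (- (lam * (\<integral>z. h z \<partial>lborel)))))"
proof -
  obtain D :: "(real ^ 2) set" where D: "countable D" "\<And>U. open U \<Longrightarrow> U \<noteq> {} \<Longrightarrow> \<exists>d\<in>D. d \<in> U"
    using countable_dense_exists by metis
  define d where "d = from_nat_into D"
  define \<delta> where "\<delta> n = 1 / real (Suc n)" for n
  have \<delta>: "\<delta> n > 0" for n by (simp add: \<delta>_def)
  have \<delta>_lim: "\<delta> \<longlonglongrightarrow> 0" unfolding \<delta>_def by real_asymp
  \<comment> \<open>Each point is assigned the first centre of a dense sequence closer than
    \<open>\<delta> n\<close>, which cuts the plane into countably many bounded measurable
    cells.\<close>
  define idx where "idx n x = (LEAST k. dist x (d k) < \<delta> n)" for n x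
  have idx: "dist x (d (idx n x)) < \<delta> n" for n x
  proof -
    obtain y where "y \<in> D" "y \<in> ball x (\<delta> n)" using D(2)[of "ball x (\<delta> n)"] \<delta>[of n] by auto
    then have "dist x (d (to_nat_on D y)) < \<delta> n"
      using D(1) by (simp add: d_def)
    then show ?thesis unfolding idx_def by (rule LeastI)
  qed
  have idx_meas [measurable]: "idx n \<in> borel \<rightarrow>\<^sub>M count_space UNIV" for n
    unfolding idx_def by measurable
  have bdd: "bounded {x. idx n x = k}" for n k
    by (rule bounded_subset[OF bounded_ball[of "d k" "\<delta> n"]]) (use idx[of _ n] in \<open>auto simp: dist_commute\<close>)
  \<comment> \<open>Replacing the base point by the centre \<open>d k\<close> changes distances by
    less than \<open>\<delta> n\<close>; adding \<open>\<delta> n\<close> keeps \<open>f\<close>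
    below \<open>h\<close> because \<open>p\<close> is antitone. The value 0 on the cell itself is
    what the formula for partitions demands.\<close>
  define f where "f n k y = (if idx n y = k then 0 else p (norm (y - d k) + \<delta> n))" for n k y
  have h01: "0 \<le> h z" "h z \<le> 1" for z using p01 by (auto simp: h)
  have h_meas [measurable]: "h \<in> borel_measurable borel"
    using borel_measurable_integrable[OF int] by simp
  have f_meas [measurable]: "f n k \<in> borel_measurable borel" for n k
  proof -
    have [measurable]: "(\<lambda>y. p (norm (y - d k) + \<delta> n)) \<in> borel_measurable borel"
      by (intro borel_measurable_continuous_onI continuous_on_compose2[OF cont] continuous_intros)
        (auto intro: add_nonneg_pos \<delta>)
    show ?thesis unfolding f_def by measurable
  qed
  have f01: "0 \<le> f n k y" "f n k y \<le> 1" for n k y using p01 by (auto simp: f_def)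
  have f_le: "f n (idx n x) y \<le> h (y - x)" for n x y
  proof (cases "idx n y = idx n x")
    case False
    have "norm (y - x) \<le> norm (y - d (idx n x)) + \<delta> n"
      using idx[of x n] dist_triangle[of y x "d (idx n x)"] by (simp add: dist_norm norm_minus_commute)
    with False show ?thesis by (auto simp: f_def h intro!: anti)
  qed (simp add: f_def h01)
  have f_lim: "(\<lambda>n. f n (idx n x) y) \<longlonglongrightarrow> h (y - x)" for x y
  proof (cases "y = x")
    case True
    then show ?thesis by (simp add: f_def h)
  next
    case False
    have d_lim: "(\<lambda>n. d (idx n x)) \<longlonglongrightarrow> x"
    proof (rule tendstoI)
      fix e :: real assume "e > 0"
      from order_tendstoD(2)[OF \<delta>_lim this]
      show "eventually (\<lambda>n. dist (d (idx n x)) x < e) sequentially"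
        by eventually_elim (use idx[of x] in \<open>auto simp: dist_commute intro: less_trans\<close>)
    qed
    have "isCont p (norm (y - x))"
      using cont False by (auto simp: continuous_on_eq_continuous_at)
    moreover have "(\<lambda>n. norm (y - d (idx n x)) + \<delta> n) \<longlonglongrightarrow> norm (y - x) + 0"
      by (intro tendsto_intros d_lim \<delta>_lim)
    ultimately have "(\<lambda>n. p (norm (y - d (idx n x)) + \<delta> n)) \<longlonglongrightarrow> p (norm (y - x))"
      by (auto intro: isCont_tendsto_compose)
    moreover have "eventually (\<lambda>n. p (norm (y - d (idx n x)) + \<delta> n) = f n (idx n x) y) sequentially"
    proof -
      \<comment> \<open>Two points of one cell are less than \<open>2 * \<delta> n\<close> apart, so
        distinct points eventually lie in different cells.\<close>
      have "eventually (\<lambda>n. \<delta> n < dist y x / 2) sequentially"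
        using False by (intro order_tendstoD(2)[OF \<delta>_lim]) simp
      then show ?thesis
      proof eventually_elim
        case (elim n)
        have "idx n y \<noteq> idx n x"
        proof
          assume "idx n y = idx n x"
          then show False
            using elim idx[of x n] idx[of y n] dist_triangle2[of y x "d (idx n x)"] by simp
        qed
        then show ?case by (simp add: f_def)
      qed
    qed
    ultimately show ?thesis
      using False by (auto simp: h intro: Lim_transform_eventually)
  qed
  have int_shift: "integrable lborel (\<lambda>y. h (y - x))" for x
    by (rule integrable_lborel_diff[OF int])
  have f_int: "integrable lborel (f n (idx n x))" for n x
    by (rule Bochner_Integration.integrable_bound[OF int_shift[of x]])
      (use f_le f01 h01 in auto)
  have eq: "(\<Sum>i. \<integral>\<^sup>+\<omega>. indicator B (X \<omega> i) * iprod (\<lambda>j. 1 - f n (idx n (X \<omega> i)) (X \<omega> j)) \<partial>M)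
    = ennreal lam * (\<integral>\<^sup>+x. indicator B x * ennreal (exp (- (lam * (\<integral>y. f n (idx n x) y \<partial>lborel)))) \<partial>lborel)" for n
    by (rule suminf_expectation_iprod_partition) (auto simp: bdd f01 f_int B idx_meas f_meas, simp add: f_def)
  \<comment> \<open>The kernel 0 in the formula for partitions gives the mean number of points also
    for unbounded \<open>B\<close>. Its terms dominate the series below.\<close>
  have total: "(\<Sum>i. \<integral>\<^sup>+\<omega>. indicator B (X \<omega> i) \<partial>M) = ennreal lam * emeasure lborel B"
  proof -
    have "iprod (\<lambda>_. 1) = 1" by (simp add: iprod_def)
    then show ?thesis
      using suminf_expectation_iprod_partition[OF B idx_meas bdd, of "\<lambda>_ _. 0"] by simp
  qed
  let ?b = "\<lambda>i. \<integral>\<^sup>+\<omega>. indicator B (X \<omega> i) \<partial>M"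
  have bfin: "(\<Sum>i. ?b i) < \<infinity>"
    using fin by (simp add: total ennreal_mult_less_top)
  have iprod_le: "indicator B z * iprod g \<le> indicator B z" for z g
    using mult_left_mono[OF iprod_le_1] by fastforce
  \<comment> \<open>Dominated convergence is used twice: for the sum over \<open>i\<close>, read as
    an integral over counting measure, and for the expectation inside it.\<close>
  have "(\<lambda>n. \<Sum>i. \<integral>\<^sup>+\<omega>. indicator B (X \<omega> i) * iprod (\<lambda>j. 1 - f n (idx n (X \<omega> i)) (X \<omega> j)) \<partial>M)
    \<longlonglongrightarrow> (\<Sum>i. \<integral>\<^sup>+\<omega>. indicator B (X \<omega> i) * iprod (\<lambda>j. 1 - h (X \<omega> j - X \<omega> i)) \<partial>M)"
    unfolding nn_integral_count_space_nat[symmetric]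
  proof (rule nn_integral_dominated_convergence[where w = ?b])
    show "(\<integral>\<^sup>+i. ?b i \<partial>count_space UNIV) < \<infinity>"
      using bfin by (simp add: nn_integral_count_space_nat)
    show "AE i in count_space UNIV. (\<lambda>n. \<integral>\<^sup>+\<omega>. indicator B (X \<omega> i) * iprod (\<lambda>j. 1 - f n (idx n (X \<omega> i)) (X \<omega> j)) \<partial>M)
      \<longlonglongrightarrow> (\<integral>\<^sup>+\<omega>. indicator B (X \<omega> i) * iprod (\<lambda>j. 1 - h (X \<omega> j - X \<omega> i)) \<partial>M)"
    proof (intro AE_I2)
      fix i
      have [measurable]: "(\<lambda>\<omega>. f n (idx n (X \<omega> i)) (X \<omega> j)) \<in> borel_measurable M" for n j
        unfolding f_def by (rule measurable_compose_countable[where g = "\<lambda>\<omega>. idx n (X \<omega> i)"])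
          (use f_meas[unfolded f_def] in measurable)
      show "(\<lambda>n. \<integral>\<^sup>+\<omega>. indicator B (X \<omega> i) * iprod (\<lambda>j. 1 - f n (idx n (X \<omega> i)) (X \<omega> j)) \<partial>M)
        \<longlonglongrightarrow> (\<integral>\<^sup>+\<omega>. indicator B (X \<omega> i) * iprod (\<lambda>j. 1 - h (X \<omega> j - X \<omega> i)) \<partial>M)"
      proof (rule nn_integral_dominated_convergence[where w = "\<lambda>\<omega>. indicator B (X \<omega> i)"])
        show "?b i < \<infinity>"
          by (rule le_less_trans[OF nn_integral_mono[of _ _ "\<lambda>_. 1"]])
            (auto simp: indicator_def emeasure_space_1)
        show "AE \<omega> in M. (\<lambda>n. indicator B (X \<omega> i) * iprod (\<lambda>j. 1 - f n (idx n (X \<omega> i)) (X \<omega> j)))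
          \<longlonglongrightarrow> indicator B (X \<omega> i) * iprod (\<lambda>j. 1 - h (X \<omega> j - X \<omega> i))"
        proof (intro AE_I2)
          fix \<omega>
          have "(\<lambda>n. iprod (\<lambda>j. 1 - f n (idx n (X \<omega> i)) (X \<omega> j))) \<longlonglongrightarrow> iprod (\<lambda>j. 1 - h (X \<omega> j - X \<omega> i))"
            by (rule iprod_tendsto_from_above) (auto intro!: tendsto_intros f_lim simp: h01 f_le)
          then show "(\<lambda>n. indicator B (X \<omega> i) * iprod (\<lambda>j. 1 - f n (idx n (X \<omega> i)) (X \<omega> j)))
            \<longlonglongrightarrow> indicator B (X \<omega> i) * iprod (\<lambda>j. 1 - h (X \<omega> j - X \<omega> i))"
            by (intro tendsto_mult_ennreal) (auto simp: indicator_def)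
        qed
      qed (auto simp: iprod_le)
    qed
  qed (auto intro!: nn_integral_mono iprod_le)
  moreover have "(\<lambda>n. ennreal lam * (\<integral>\<^sup>+x. indicator B x * ennreal (exp (- (lam * (\<integral>y. f n (idx n x) y \<partial>lborel)))) \<partial>lborel))
    \<longlonglongrightarrow> ennreal lam * (\<integral>\<^sup>+x. indicator B x * ennreal (exp (- (lam * (\<integral>z. h z \<partial>lborel)))) \<partial>lborel)"
  proof (intro tendsto_mult_ennreal tendsto_const)
    show "(\<lambda>n. (\<integral>\<^sup>+x. indicator B x * ennreal (exp (- (lam * (\<integral>y. f n (idx n x) y \<partial>lborel)))) \<partial>lborel))
      \<longlonglongrightarrow> (\<integral>\<^sup>+x. indicator B x * ennreal (exp (- (lam * (\<integral>z. h z \<partial>lborel)))) \<partial>lborel)"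
    proof (rule nn_integral_dominated_convergence[where w = "indicator B"])
      show "AE x in lborel. indicator B x * ennreal (exp (- (lam * (\<integral>y. f n (idx n x) y \<partial>lborel)))) \<le> indicator B x" for n
        using f01 lam by (auto intro!: AE_I2 simp: indicator_def integral_nonneg_AE)
      show "AE x in lborel. (\<lambda>n. indicator B x * ennreal (exp (- (lam * (\<integral>y. f n (idx n x) y \<partial>lborel)))))
        \<longlonglongrightarrow> indicator B x * ennreal (exp (- (lam * (\<integral>z. h z \<partial>lborel))))"
      proof (intro AE_I2 tendsto_mult_ennreal tendsto_const tendsto_ennrealI tendsto_exp tendsto_minus tendsto_mult)
        fix x
        have "(\<lambda>n. \<integral>y. f n (idx n x) y \<partial>lborel) \<longlonglongrightarrow> (\<integral>y. h (y - x) \<partial>lborel)"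
          by (rule integral_dominated_convergence[where w = "\<lambda>y. h (y - x)"])
            (use f_le f01 f_lim int_shift in auto)
        then show "(\<lambda>n. \<integral>y. f n (idx n x) y \<partial>lborel) \<longlonglongrightarrow> (\<integral>z. h z \<partial>lborel)"
          by (simp add: integral_lborel_diff)
      qed (auto simp: indicator_def)
    qed (use fin in \<open>auto intro!: measurable_compose_countable[where f = "\<lambda>k x. ennreal (exp (- (lam * (\<integral>y. f _ k y \<partial>lborel))))"]\<close>)
  qed (use fin in \<open>auto simp: nn_integral_multc ennreal_mult_eq_top_iff\<close>)
  ultimately have "(\<Sum>i. \<integral>\<^sup>+\<omega>. indicator B (X \<omega> i) * iprod (\<lambda>j. 1 - h (X \<omega> j - X \<omega> i)) \<partial>M)
    = ennreal lam * (\<integral>\<^sup>+x. indicator B x * ennreal (exp (- (lam * (\<integral>z. h z \<partial>lborel)))) \<partial>lborel)"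
    unfolding eq by (rule LIMSEQ_unique)
  then show ?thesis by (simp add: nn_integral_multc)
qed

end

section \<open>Independent sources of randomness\<close>

text \<open>By independence, the image of \<open>M\<close> under the diagonal map agrees on
  rectangles with the product of the restrictions of \<open>M\<close> to \<open>S\<close> and
  \<open>T\<close>, hence everywhere. The \<open>T\<close> part may thus be resampled as an
  independent copy; this takes the place of conditioning on \<open>S\<close>.\<close>

lemma (in prob_space) nn_integral_indep_diagonal:
  assumes S: "subalgebra M S" and T: "subalgebra M T"
    and indep: "\<And>A B. A \<in> sets S \<Longrightarrow> B \<in> sets T \<Longrightarrow> prob (A \<inter> B) = prob A * prob B"
    and f [measurable]: "(\<lambda>(\<omega>, \<omega>'). f \<omega> \<omega>') \<in> borel_measurable (S \<Otimes>\<^sub>M T)"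
  shows "(\<integral>\<^sup>+\<omega>. f \<omega> \<omega> \<partial>M) = (\<integral>\<^sup>+\<omega>. \<integral>\<^sup>+\<omega>'. f \<omega> \<omega>' \<partial>M \<partial>M)"
proof -
  let ?S = "restr_to_subalg M S" and ?T = "restr_to_subalg M T"
  interpret S: prob_space ?S by (rule prob_space_restr_to_subalg[OF S]) (rule prob_space_axioms)
  interpret T: prob_space ?T by (rule prob_space_restr_to_subalg[OF T]) (rule prob_space_axioms)
  note [measurable_cong] = sets_restr_to_subalg[OF S] sets_restr_to_subalg[OF T]
  have "(\<lambda>\<omega>. \<omega>) \<in> M \<rightarrow>\<^sub>M S" "(\<lambda>\<omega>. \<omega>) \<in> M \<rightarrow>\<^sub>M T"
    using S T by (auto intro: measurable_from_subalg)
  then have diag [measurable]: "(\<lambda>\<omega>. (\<omega>, \<omega>)) \<in> M \<rightarrow>\<^sub>M S \<Otimes>\<^sub>M T" by measurable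
  have prod: "?S \<Otimes>\<^sub>M ?T = distr M (S \<Otimes>\<^sub>M T) (\<lambda>\<omega>. (\<omega>, \<omega>))"
  proof (rule pair_measure_eqI)
    fix A B assume "A \<in> sets ?S" "B \<in> sets ?T"
    then have A: "A \<in> sets S" and B: "B \<in> sets T"
      by (simp_all add: sets_restr_to_subalg S T)
    then have "A \<in> events" "B \<in> events" using S T by (auto simp: subalgebra_def)
    moreover have "(\<lambda>\<omega>. (\<omega>, \<omega>)) -` (A \<times> B) \<inter> space M = A \<inter> B"
      using sets.sets_into_space[OF \<open>A \<in> events\<close>] by auto
    ultimately show "emeasure ?S A * emeasure ?T B = emeasure (distr M (S \<Otimes>\<^sub>M T) (\<lambda>\<omega>. (\<omega>, \<omega>))) (A \<times> B)"
      using A B indep[OF A B]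
      by (simp add: emeasure_restr_to_subalg S T emeasure_distr emeasure_eq_measure ennreal_mult)
  qed (auto intro: S.sigma_finite_measure_axioms T.sigma_finite_measure_axioms
      simp: sets_restr_to_subalg S T cong: sets_pair_measure_cong)
  have "(\<integral>\<^sup>+\<omega>. f \<omega> \<omega> \<partial>M) = (\<integral>\<^sup>+z. (\<lambda>(\<omega>, \<omega>'). f \<omega> \<omega>') z \<partial>(distr M (S \<Otimes>\<^sub>M T) (\<lambda>\<omega>. (\<omega>, \<omega>))))"
    by (subst nn_integral_distr) auto
  also have "\<dots> = (\<integral>\<^sup>+\<omega>. \<integral>\<^sup>+\<omega>'. f \<omega> \<omega>' \<partial>?T \<partial>?S)"
    unfolding prod[symmetric] by (subst T.nn_integral_fst[symmetric]) auto
  also have "\<dots> = (\<integral>\<^sup>+\<omega>. \<integral>\<^sup>+\<omega>'. f \<omega> \<omega>' \<partial>?T \<partial>M)"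
    by (rule nn_integral_subalgebra2[OF S])
      (use T.borel_measurable_nn_integral_fst[of "\<lambda>(\<omega>, \<omega>'). f \<omega> \<omega>'" S] in simp)
  also have "\<dots> = (\<integral>\<^sup>+\<omega>. \<integral>\<^sup>+\<omega>'. f \<omega> \<omega>' \<partial>M \<partial>M)"
  proof (rule nn_integral_cong)
    fix \<omega> assume "\<omega> \<in> space M"
    then have "\<omega> \<in> space S" using S by (simp add: subalgebra_def)
    then have "f \<omega> \<in> borel_measurable T"
      using measurable_compose[OF measurable_Pair1' f] by simp
    then show "(\<integral>\<^sup>+\<omega>'. f \<omega> \<omega>' \<partial>?T) = (\<integral>\<^sup>+\<omega>'. f \<omega> \<omega>' \<partial>M)"
      by (rule nn_integral_subalgebra2[OF T])
  qed
  finally show ?thesis .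
qed

locale independent_network = prob_space M for M :: "'a measure" +
  fixes N :: "'a \<Rightarrow> network"
  assumes indep: "indep_sets (source_events M N) UNIV"
begin

text \<open>Measurability with respect to \<open>sources J\<close> records which sources a quantity
  depends on; disjoint sets of sources give independent \<sigma>-algebras.\<close>

definition sources :: "source set \<Rightarrow> 'a measure" where
  "sources J = sigma (space M) (\<Union>s\<in>J. source_events M N s)"

lemma source_events_subset: "source_events M N s \<subseteq> events"
  using indep by (auto simp: indep_sets_def)

lemma source_events_space: "(\<Union>s\<in>J. source_events M N s) \<subseteq> Pow (space M)"
  using source_events_subset sets.sets_into_space by blast

lemma space_sources [simp]: "space (sources J) = space M"
  unfolding sources_def by (rule space_measure_of[OF source_events_space])

lemma sets_sources: "sets (sources J) = sigma_sets (space M) (\<Union>s\<in>J. source_events M N s)"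
  unfolding sources_def by (rule sets_measure_of[OF source_events_space])

lemma subalgebra_sources: "subalgebra M (sources J)"
  unfolding subalgebra_def sets_sources
  using source_events_subset by (auto intro!: sets.sigma_sets_subset)

text \<open>Each source contributes a \<sigma>-algebra, hence an intersection-stable generator, so
  independence survives grouping into disjoint blocks.\<close>

lemma indep_sources:
  assumes "disjoint_family_on I J"
  shows "indep_sets (\<lambda>j. sets (sources (I j))) J"
  unfolding sets_sources
proof (rule indep_sets_collect_sigma[OF _ _ assms])
  show "indep_sets (source_events M N) (\<Union>j\<in>J. I j)"
    by (rule indep_sets_mono_index[OF _ indep]) simp
  show "Int_stable (source_events M N s)" for s
    by (cases s) (auto intro: sets.Int_stable)
qed

text \<open>In applications \<open>J\<close> collects the sources held fixed and \<open>K\<close>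
  those averaged over.\<close>

lemma nn_integral_sources_diagonal:
  assumes "J \<inter> K = {}" and f: "(\<lambda>(\<omega>, \<omega>'). f \<omega> \<omega>') \<in> borel_measurable (sources J \<Otimes>\<^sub>M sources K)"
  shows "(\<integral>\<^sup>+\<omega>. f \<omega> \<omega> \<partial>M) = (\<integral>\<^sup>+\<omega>. \<integral>\<^sup>+\<omega>'. f \<omega> \<omega>' \<partial>M \<partial>M)"
proof (rule nn_integral_indep_diagonal[OF subalgebra_sources subalgebra_sources _ f])
  fix A B assume AB: "A \<in> sets (sources J)" "B \<in> sets (sources K)"
  have "indep_sets (\<lambda>b. sets (sources (case_bool J K b))) UNIV"
    using assms(1) by (intro indep_sources) (auto simp: disjoint_family_on_def split: bool.splits)
  from indep_setsD[OF this, of UNIV "case_bool A B"] AB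
  show "prob (A \<inter> B) = prob A * prob B"
    by (simp add: UNIV_bool ac_simps)
qed

lemma measurable_sources:
  assumes "s \<in> J" "source_events M N s = sets (vimage_algebra (space M) f L)" "f \<in> space M \<rightarrow> space L"
  shows "f \<in> sources J \<rightarrow>\<^sub>M L"
proof (rule measurable_from_subalg)
  show "f \<in> vimage_algebra (space M) f L \<rightarrow>\<^sub>M L"
    by (rule measurable_vimage_algebra1) (rule assms)
  show "subalgebra (sources J) (vimage_algebra (space M) f L)"
    using assms(1,2) by (auto simp: subalgebra_def sets_sources)
qed

lemma measurable_ap: "APs \<in> J \<Longrightarrow> (\<lambda>\<omega>. ap (N \<omega>) i) \<in> borel_measurable (sources J)"
  by (rule measurable_compose[OF measurable_sources[of APs J "\<lambda>\<omega>. ap (N \<omega>)"] measurable_component_singleton])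
    (auto simp: space_PiM)

lemma measurable_enb: "ENBs \<in> J \<Longrightarrow> (\<lambda>\<omega>. enb (N \<omega>) k) \<in> borel_measurable (sources J)"
  by (rule measurable_compose[OF measurable_sources[of ENBs J "\<lambda>\<omega>. enb (N \<omega>)"] measurable_component_singleton])
    (auto simp: space_PiM)

lemma measurable_timer: "Timer i \<in> J \<Longrightarrow> (\<lambda>\<omega>. timer (N \<omega>) i) \<in> borel_measurable (sources J)"
  by (rule measurable_sources) auto

lemma measurable_fading_W: "Fading_W j i \<in> J \<Longrightarrow> (\<lambda>\<omega>. fading_W (N \<omega>) j i) \<in> borel_measurable (sources J)"
  by (rule measurable_sources) auto

lemma measurable_fading_LW: "Fading_LW k i \<in> J \<Longrightarrow> (\<lambda>\<omega>. fading_LW (N \<omega>) k i) \<in> borel_measurable (sources J)"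
  by (rule measurable_sources) auto

lemmas measurable_network [measurable (raw)] =
  measurable_ap measurable_enb measurable_timer measurable_fading_W measurable_fading_LW

lemmas measurable_network_M [measurable] =
  measurable_network[where J = UNIV, OF UNIV_I, THEN measurable_from_subalg[OF subalgebra_sources]]

end

section \<open>Access probability of one AP\<close>

text \<open>\<open>cW\<close> and \<open>cL\<close> stand for the ratios of threshold to transmit
  power, and \<open>l\<close> for the path loss as a function of the displacement.\<close>

locale wifi_lte_network = independent_network M N for M :: "'a measure" and N +
  fixes \<mu> cW cL :: real and l :: "real ^ 2 \<Rightarrow> real"
  assumes \<mu>: "\<mu> > 0" and cW: "cW > 0" and cL: "cL > 0"
    and l_measurable [measurable]: "l \<in> borel_measurable borel"
    and l_0 [simp]: "l 0 = 0" and l_pos: "\<And>z. z \<noteq> 0 \<Longrightarrow> l z > 0"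
    and timer: "\<And>i. distributed M lborel (\<lambda>\<omega>. timer (N \<omega>) i) (indicator {0..1})"
    and fading_W: "\<And>j i. distributed M lborel (\<lambda>\<omega>. fading_W (N \<omega>) j i) (\<lambda>x. ennreal (exponential_density \<mu> x))"
    and fading_LW: "\<And>k i. distributed M lborel (\<lambda>\<omega>. fading_LW (N \<omega>) k i) (\<lambda>x. ennreal (exponential_density \<mu> x))"
begin

text \<open>The tail of the exponential law at \<open>c * l z\<close>. At the origin the quotient is
  \<open>x / 0 = 0\<close>, which never exceeds the threshold, whence the value 0 instead of
  \<open>exp 0\<close>.\<close>

definition loud_prob :: "real \<Rightarrow> real ^ 2 \<Rightarrow> real" where
  "loud_prob c z = (if z = 0 then 0 else exp (- (\<mu> * c * l z)))"

lemma loud_prob_nonneg: "0 \<le> loud_prob c z"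
  by (simp add: loud_prob_def)

lemma loud_prob_le_1: "c > 0 \<Longrightarrow> loud_prob c z \<le> 1"
  using \<mu> l_pos[of z] by (cases "z = 0") (simp_all add: loud_prob_def)

lemma loud_prob_measurable [measurable]: "loud_prob c \<in> borel_measurable borel"
  unfolding loud_prob_def by measurable

lemma prob_quiet:
  assumes G: "distributed M lborel G (\<lambda>x. ennreal (exponential_density \<mu> x))" and c: "c > 0"
  shows "prob {\<omega> \<in> space M. G \<omega> / l z \<le> c} = 1 - loud_prob c z"
proof (cases "z = 0")
  case True
  then show ?thesis using c by (simp add: loud_prob_def prob_space)
next
  case False
  then have l: "l z > 0" by (rule l_pos)
  then have "{\<omega> \<in> space M. G \<omega> / l z \<le> c} = {\<omega> \<in> space M. G \<omega> \<le> c * l z}"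
    by (simp add: field_simps)
  also have "prob \<dots> = 1 - exp (- (c * l z) * \<mu>)"
    using G l c \<mu> by (intro exponential_distributedD_le) auto
  finally show ?thesis using False by (simp add: loud_prob_def mult.commute mult.left_commute)
qed

lemma prob_timer_less:
  assumes "0 \<le> t" "t \<le> 1"
  shows "prob {\<omega> \<in> space M. timer (N \<omega>) j < t} = t"
proof -
  have "emeasure M ((\<lambda>\<omega>. timer (N \<omega>) j) -` {..<t} \<inter> space M) = (\<integral>\<^sup>+x. indicator {0..1} x * indicator {..<t} x \<partial>lborel)"
    by (rule distributed_emeasure[OF timer]) simp
  also have "\<dots> = (\<integral>\<^sup>+x. indicator {0..<t} x \<partial>lborel)"
    using assms by (intro nn_integral_cong) (auto simp: indicator_def)
  also have "\<dots> = ennreal t" using assms by simp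
  finally show ?thesis
    using assms by (simp add: measure_def vimage_def Int_def conj_commute)
qed

text \<open>The timer and the fading are separate sources, so the probabilities of being earlier and
  of being loud multiply.\<close>

lemma prob_earlier_and_loud:
  assumes t: "0 \<le> t" "t \<le> 1"
  shows "prob {\<omega> \<in> space M. timer (N \<omega>) j < t \<and> \<not> fading_W (N \<omega>) j i / l z \<le> cW} = t * loud_prob cW z"
proof -
  let ?A = "case_bool {\<omega> \<in> space M. timer (N \<omega>) j < t} {\<omega> \<in> space M. \<not> fading_W (N \<omega>) j i / l z \<le> cW}"
  have "indep_sets (\<lambda>b. sets (sources (case_bool {Timer j} {Fading_W j i} b))) UNIV"
    by (intro indep_sources) (auto simp: disjoint_family_on_def split: bool.splits)
  moreover have "?A b \<in> sets (sources (case_bool {Timer j} {Fading_W j i} b))" for b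
  proof -
    have "{\<omega> \<in> space (sources {Timer j}). timer (N \<omega>) j < t} \<in> sets (sources {Timer j})"
      by measurable
    moreover have "{\<omega> \<in> space (sources {Fading_W j i}). \<not> fading_W (N \<omega>) j i / l z \<le> cW} \<in> sets (sources {Fading_W j i})"
      by measurable
    ultimately show ?thesis by (cases b) simp_all
  qed
  ultimately have "prob (\<Inter>b\<in>UNIV. ?A b) = (\<Prod>b\<in>UNIV. prob (?A b))"
    by (intro indep_setsD) auto
  then have "prob {\<omega> \<in> space M. timer (N \<omega>) j < t \<and> \<not> fading_W (N \<omega>) j i / l z \<le> cW}
    = prob {\<omega> \<in> space M. timer (N \<omega>) j < t} * prob {\<omega> \<in> space M. \<not> fading_W (N \<omega>) j i / l z \<le> cW}"
    by (simp add: UNIV_bool Int_def mult.commute conj_ac)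
  moreover have "prob {\<omega> \<in> space M. \<not> fading_W (N \<omega>) j i / l z \<le> cW} = loud_prob cW z"
    using prob_neg[of "\<lambda>\<omega>. fading_W (N \<omega>) j i / l z \<le> cW"] prob_quiet[OF fading_W cW] by simp
  ultimately show ?thesis by (simp add: prob_timer_less t)
qed

text \<open>With positions and \<open>t\<close> frozen, the events of different nodes use disjoint
  sources: one fading for an eNB, timer and fading for an AP. Finite intersections therefore
  factorise, and continuity from above gives the infinite one. As \<open>t\<close> is a constant,
  the timer of AP \<open>i\<close> takes part like any other.\<close>

lemma prob_access_given_points:
  assumes t: "0 \<le> t" "t \<le> 1"
  shows "emeasure M {\<omega> \<in> space M. (\<forall>k. fading_LW (N \<omega>) k i / l (y k) \<le> cL) \<and>
      (\<forall>j. timer (N \<omega>) j < t \<longrightarrow> fading_W (N \<omega>) j i / l (x j) \<le> cW)}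
    = iprod (\<lambda>k. 1 - loud_prob cL (y k)) * iprod (\<lambda>j. 1 - t * loud_prob cW (x j))"
proof -
  let ?I = "case_sum (\<lambda>k. {Fading_LW k i}) (\<lambda>j. {Timer j, Fading_W j i})"
  let ?A = "case_sum (\<lambda>k. {\<omega> \<in> space M. fading_LW (N \<omega>) k i / l (y k) \<le> cL})
    (\<lambda>j. {\<omega> \<in> space M. timer (N \<omega>) j < t \<longrightarrow> fading_W (N \<omega>) j i / l (x j) \<le> cW})"
  \<comment> \<open>\<open>Suc n\<close> keeps these index sets nonempty, as the product rule for
    independent events requires.\<close>
  let ?J = "\<lambda>n. {..<Suc n} <+> {..<Suc n}"
  have ind: "indep_sets (\<lambda>s. sets (sources (?I s))) UNIV"
    by (intro indep_sources) (auto simp: disjoint_family_on_def split: sum.splits)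
  have A: "?A s \<in> sets (sources (?I s))" for s
  proof (cases s)
    case (Inl k)
    have "{\<omega> \<in> space (sources {Fading_LW k i}). fading_LW (N \<omega>) k i / l (y k) \<le> cL} \<in> sets (sources {Fading_LW k i})"
      by measurable
    with Inl show ?thesis by simp
  next
    case (Inr j)
    have "{\<omega> \<in> space (sources {Timer j, Fading_W j i}). timer (N \<omega>) j < t \<longrightarrow> fading_W (N \<omega>) j i / l (x j) \<le> cW}
        \<in> sets (sources {Timer j, Fading_W j i})"
      by measurable
    with Inr show ?thesis by simp
  qed
  then have A_events: "?A s \<in> events" for s
    using subalgebra_sources by (auto simp: subalgebra_def)
  have pL: "prob (?A (Inl k)) = 1 - loud_prob cL (y k)" for k
    using prob_quiet[OF fading_LW cL] by simp
  have pW: "prob (?A (Inr j)) = 1 - t * loud_prob cW (x j)" for j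
  proof -
    have "?A (Inr j) = {\<omega> \<in> space M. \<not> (timer (N \<omega>) j < t \<and> \<not> fading_W (N \<omega>) j i / l (x j) \<le> cW)}"
      by auto
    then show ?thesis
      using prob_neg[of "\<lambda>\<omega>. timer (N \<omega>) j < t \<and> \<not> fading_W (N \<omega>) j i / l (x j) \<le> cW"]
        prob_earlier_and_loud[OF t, of j i "x j"] by simp
  qed
  have fin: "prob (\<Inter>s\<in>?J n. ?A s) = (\<Prod>k<Suc n. 1 - loud_prob cL (y k)) * (\<Prod>j<Suc n. 1 - t * loud_prob cW (x j))" for n
  proof -
    have "prob (\<Inter>s\<in>?J n. ?A s) = (\<Prod>s\<in>?J n. prob (?A s))"
      by (rule indep_setsD[OF ind]) (use A in auto)
    also have "\<dots> = (\<Prod>k<Suc n. prob (?A (Inl k))) * (\<Prod>j<Suc n. prob (?A (Inr j)))"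
      by (subst prod.Plus) (simp_all only: finite_lessThan comp_def)
    finally show ?thesis by (simp only: pL pW)
  qed
  have "(\<lambda>n. prob (\<Inter>s\<in>?J n. ?A s)) \<longlonglongrightarrow> prob (\<Inter>n. \<Inter>s\<in>?J n. ?A s)"
  proof (rule finite_Lim_measure_decseq)
    show "range (\<lambda>n. \<Inter>s\<in>?J n. ?A s) \<subseteq> events"
      using A_events by (intro image_subsetI sets.finite_INT) auto
    show "decseq (\<lambda>n. \<Inter>s\<in>?J n. ?A s)"
      unfolding decseq_def by (intro allI impI INT_anti_mono) auto
  qed
  then have lim: "(\<lambda>n. ennreal (prob (\<Inter>s\<in>?J n. ?A s))) \<longlonglongrightarrow> emeasure M (\<Inter>n. \<Inter>s\<in>?J n. ?A s)"
    unfolding emeasure_eq_measure by (rule tendsto_ennrealI)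
  have "(\<lambda>n. ennreal (prob (\<Inter>s\<in>?J n. ?A s)))
    \<longlonglongrightarrow> iprod (\<lambda>k. 1 - loud_prob cL (y k)) * iprod (\<lambda>j. 1 - t * loud_prob cW (x j))"
  proof -
    have L: "0 \<le> 1 - loud_prob cL z" "1 - loud_prob cL z \<le> 1" for z
      by (auto simp: loud_prob_nonneg loud_prob_le_1 cL)
    have W: "0 \<le> 1 - t * loud_prob cW z" "1 - t * loud_prob cW z \<le> 1" for z
      using t by (auto simp: loud_prob_nonneg loud_prob_le_1 cW intro!: mult_le_one)
    show ?thesis
      unfolding fin
      by (subst ennreal_mult) (auto simp del: prod.lessThan_Suc intro!: prod_nonneg L W tendsto_mult_ennreal
        LIMSEQ_Suc[OF iprod_tendsto[OF L]] LIMSEQ_Suc[OF iprod_tendsto[OF W]])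
  qed
  from LIMSEQ_unique[OF lim this]
  have "emeasure M (\<Inter>n. \<Inter>s\<in>?J n. ?A s) = iprod (\<lambda>k. 1 - loud_prob cL (y k)) * iprod (\<lambda>j. 1 - t * loud_prob cW (x j))" .
  also have "(\<Inter>n. \<Inter>s\<in>?J n. ?A s) = {\<omega> \<in> space M. (\<forall>k. fading_LW (N \<omega>) k i / l (y k) \<le> cL) \<and>
      (\<forall>j. timer (N \<omega>) j < t \<longrightarrow> fading_W (N \<omega>) j i / l (x j) \<le> cW)}"
  proof -
    have *: "(\<Inter>n. \<Inter>s\<in>J n. A s) = (\<Inter>s. A s)" if "\<And>s. \<exists>n. s \<in> J n"
      for J :: "nat \<Rightarrow> (nat + nat) set" and A :: "nat + nat \<Rightarrow> 'a set"
      using that by blast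
    have "\<exists>n. s \<in> ?J n" for s
      by (cases s) auto
    then have "(\<Inter>n. \<Inter>s\<in>?J n. ?A s) = (\<Inter>s. ?A s)" by (rule *)
    also have "\<dots> = (\<Inter>k. ?A (Inl k)) \<inter> (\<Inter>j. ?A (Inr j))"
      by (simp only: set_eq_iff Int_iff INT_iff ball_UNIV split_sum_all simp_thms)
    also have "\<dots> = {\<omega> \<in> space M. (\<forall>k. fading_LW (N \<omega>) k i / l (y k) \<le> cL) \<and>
        (\<forall>j. timer (N \<omega>) j < t \<longrightarrow> fading_W (N \<omega>) j i / l (x j) \<le> cW)}"
      by auto
    finally show ?thesis .
  qed
  finally show ?thesis .
qed

text \<open>The positions and the timer of AP \<open>i\<close> are held fixed, while the fadings and
  the other timers are averaged over an independent copy.\<close>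

lemma emeasure_access:
  assumes [measurable]: "B \<in> sets borel"
  shows "emeasure M {\<omega> \<in> space M. ap (N \<omega>) i \<in> B \<and>
      (\<forall>k. fading_LW (N \<omega>) k i / l (enb (N \<omega>) k - ap (N \<omega>) i) \<le> cL) \<and>
      (\<forall>j. timer (N \<omega>) j < timer (N \<omega>) i \<longrightarrow> fading_W (N \<omega>) j i / l (ap (N \<omega>) j - ap (N \<omega>) i) \<le> cW)}
    = (\<integral>\<^sup>+\<omega>. indicator B (ap (N \<omega>) i) * (iprod (\<lambda>k. 1 - loud_prob cL (enb (N \<omega>) k - ap (N \<omega>) i)) *
        iprod (\<lambda>j. 1 - timer (N \<omega>) i * loud_prob cW (ap (N \<omega>) j - ap (N \<omega>) i))) \<partial>M)"
proof -
  \<comment> \<open>The index \<open>j = i\<close> is excluded because the timer of AP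
    \<open>i\<close> belongs to the fixed sources and must not be read from the copy
    \<open>\<omega>'\<close>.\<close>
  define P where "P \<omega> \<omega>' \<longleftrightarrow>
      (\<forall>k. fading_LW (N \<omega>') k i / l (enb (N \<omega>) k - ap (N \<omega>) i) \<le> cL) \<and>
      (\<forall>j\<in>-{i}. timer (N \<omega>') j < timer (N \<omega>) i \<longrightarrow> fading_W (N \<omega>') j i / l (ap (N \<omega>) j - ap (N \<omega>) i) \<le> cW)"
    for \<omega> \<omega>'
  define f where "f \<omega> \<omega>' = indicator B (ap (N \<omega>) i) * (if P \<omega> \<omega>' then 1 else 0 :: ennreal)" for \<omega> \<omega>'
  define J where "J = {APs, ENBs, Timer i}"
  define K where "K = range (\<lambda>k. Fading_LW k i) \<union> range (\<lambda>j. Fading_W j i) \<union> Timer ` (- {i})"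
  have [measurable]: "(\<lambda>\<omega>. ap (N \<omega>) j) \<in> borel_measurable (sources J)"
    "(\<lambda>\<omega>. enb (N \<omega>) j) \<in> borel_measurable (sources J)"
    "(\<lambda>\<omega>. timer (N \<omega>) i) \<in> borel_measurable (sources J)"
    "(\<lambda>\<omega>. fading_LW (N \<omega>) j i) \<in> borel_measurable (sources K)"
    "(\<lambda>\<omega>. fading_W (N \<omega>) j i) \<in> borel_measurable (sources K)"
    "j \<in> - {i} \<Longrightarrow> (\<lambda>\<omega>. timer (N \<omega>) j) \<in> borel_measurable (sources K)" for j
    by (auto simp: J_def K_def intro!: measurable_network)
  have "emeasure M {\<omega> \<in> space M. ap (N \<omega>) i \<in> B \<and>
      (\<forall>k. fading_LW (N \<omega>) k i / l (enb (N \<omega>) k - ap (N \<omega>) i) \<le> cL) \<and>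
      (\<forall>j. timer (N \<omega>) j < timer (N \<omega>) i \<longrightarrow> fading_W (N \<omega>) j i / l (ap (N \<omega>) j - ap (N \<omega>) i) \<le> cW)}
    = (\<integral>\<^sup>+\<omega>. indicator {\<omega> \<in> space M. ap (N \<omega>) i \<in> B \<and>
      (\<forall>k. fading_LW (N \<omega>) k i / l (enb (N \<omega>) k - ap (N \<omega>) i) \<le> cL) \<and>
      (\<forall>j. timer (N \<omega>) j < timer (N \<omega>) i \<longrightarrow> fading_W (N \<omega>) j i / l (ap (N \<omega>) j - ap (N \<omega>) i) \<le> cW)} \<omega> \<partial>M)"
    by (rule nn_integral_indicator[symmetric]) measurable
  also have "\<dots> = (\<integral>\<^sup>+\<omega>. f \<omega> \<omega> \<partial>M)"
    by (intro nn_integral_cong) (auto simp: f_def P_def indicator_def)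
  also have "\<dots> = (\<integral>\<^sup>+\<omega>. \<integral>\<^sup>+\<omega>'. f \<omega> \<omega>' \<partial>M \<partial>M)"
  proof (rule nn_integral_sources_diagonal[of J K])
    show "(\<lambda>(\<omega>, \<omega>'). f \<omega> \<omega>') \<in> borel_measurable (sources J \<Otimes>\<^sub>M sources K)"
      unfolding f_def P_def by measurable
  qed (auto simp: J_def K_def)
  also have "\<dots> = (\<integral>\<^sup>+\<omega>. indicator B (ap (N \<omega>) i) * (iprod (\<lambda>k. 1 - loud_prob cL (enb (N \<omega>) k - ap (N \<omega>) i)) *
        iprod (\<lambda>j. 1 - timer (N \<omega>) i * loud_prob cW (ap (N \<omega>) j - ap (N \<omega>) i))) \<partial>M)"
  proof (rule nn_integral_cong_AE)
    have "AE \<omega> in M. timer (N \<omega>) i \<in> {0..1}"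
      by (rule distributed_AE2[OF timer, THEN iffD2]) (auto simp: indicator_def)
    then show "AE \<omega> in M. (\<integral>\<^sup>+\<omega>'. f \<omega> \<omega>' \<partial>M) =
      indicator B (ap (N \<omega>) i) * (iprod (\<lambda>k. 1 - loud_prob cL (enb (N \<omega>) k - ap (N \<omega>) i)) *
        iprod (\<lambda>j. 1 - timer (N \<omega>) i * loud_prob cW (ap (N \<omega>) j - ap (N \<omega>) i)))"
    proof eventually_elim
      case (elim \<omega>)
      let ?E = "{\<omega>' \<in> space M. (\<forall>k. fading_LW (N \<omega>') k i / l (enb (N \<omega>) k - ap (N \<omega>) i) \<le> cL) \<and>
        (\<forall>j. timer (N \<omega>') j < timer (N \<omega>) i \<longrightarrow> fading_W (N \<omega>') j i / l (ap (N \<omega>) j - ap (N \<omega>) i) \<le> cW)}"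
      \<comment> \<open>The index \<open>j = i\<close> can be restored: its fading is divided by
        \<open>l 0 = 0\<close>, and the quotient 0 is below \<open>cW\<close> whatever the timers
        are.\<close>
      have "P \<omega> \<omega>' \<longleftrightarrow> \<omega>' \<in> ?E" if "\<omega>' \<in> space M" for \<omega>'
        using that cW by (auto simp: P_def Ball_def) (metis diff_self div_by_0 l_0 less_imp_le)
      then have "(\<integral>\<^sup>+\<omega>'. f \<omega> \<omega>' \<partial>M) = (\<integral>\<^sup>+\<omega>'. indicator B (ap (N \<omega>) i) * indicator ?E \<omega>' \<partial>M)"
        by (intro nn_integral_cong) (simp add: f_def indicator_def)
      also have "\<dots> = indicator B (ap (N \<omega>) i) * emeasure M ?E"
        by (rule nn_integral_cmult_indicator) measurable
      finally show ?case
        using elim by (simp add: prob_access_given_points)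
    qed
  qed
  finally show ?thesis .
qed

text \<open>Given the APs, the generating functional of the eNBs is evaluated at a translate of
  \<open>loud_prob cL\<close>. Lebesgue measure is translation invariant, so the result does not
  depend on the position of AP \<open>i\<close> and factors out.\<close>

lemma expectation_enb_factor:
  assumes lamL: "lamL > 0" and enb: "homogeneous_poisson_process M lamL (\<lambda>\<omega>. enb (N \<omega>))"
    and int: "integrable lborel (loud_prob cL)" and [measurable]: "B \<in> sets borel"
  shows "(\<integral>\<^sup>+\<omega>. indicator B (ap (N \<omega>) i) * (iprod (\<lambda>k. 1 - loud_prob cL (enb (N \<omega>) k - ap (N \<omega>) i)) *
        iprod (\<lambda>j. 1 - timer (N \<omega>) i * loud_prob cW (ap (N \<omega>) j - ap (N \<omega>) i))) \<partial>M)
    = ennreal (exp (- (lamL * (\<integral>z. loud_prob cL z \<partial>lborel)))) *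
      (\<integral>\<^sup>+\<omega>. indicator B (ap (N \<omega>) i) * iprod (\<lambda>j. 1 - timer (N \<omega>) i * loud_prob cW (ap (N \<omega>) j - ap (N \<omega>) i)) \<partial>M)"
proof -
  interpret enb: poisson_points M lamL "\<lambda>\<omega>. enb (N \<omega>)"
    by unfold_locales (rule lamL enb)+
  define J where "J = {APs, Timer i}"
  define K where "K = {ENBs}"
  have [measurable]: "(\<lambda>\<omega>. ap (N \<omega>) j) \<in> borel_measurable (sources J)"
    "(\<lambda>\<omega>. timer (N \<omega>) i) \<in> borel_measurable (sources J)"
    "(\<lambda>\<omega>. enb (N \<omega>) j) \<in> borel_measurable (sources K)" for j
    by (auto simp: J_def K_def intro!: measurable_network)
  let ?W = "\<lambda>\<omega>. iprod (\<lambda>j. 1 - timer (N \<omega>) i * loud_prob cW (ap (N \<omega>) j - ap (N \<omega>) i))"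
  have "(\<integral>\<^sup>+\<omega>. indicator B (ap (N \<omega>) i) * (iprod (\<lambda>k. 1 - loud_prob cL (enb (N \<omega>) k - ap (N \<omega>) i)) * ?W \<omega>) \<partial>M)
    = (\<integral>\<^sup>+\<omega>. \<integral>\<^sup>+\<omega>'. indicator B (ap (N \<omega>) i) * (iprod (\<lambda>k. 1 - loud_prob cL (enb (N \<omega>') k - ap (N \<omega>) i)) * ?W \<omega>) \<partial>M \<partial>M)"
  proof (rule nn_integral_sources_diagonal[of J K])
    show "(\<lambda>(\<omega>, \<omega>'). indicator B (ap (N \<omega>) i) * (iprod (\<lambda>k. 1 - loud_prob cL (enb (N \<omega>') k - ap (N \<omega>) i)) * ?W \<omega>))
      \<in> borel_measurable (sources J \<Otimes>\<^sub>M sources K)"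
      by measurable
  qed (auto simp: J_def K_def)
  also have "\<dots> = (\<integral>\<^sup>+\<omega>. ennreal (exp (- (lamL * (\<integral>z. loud_prob cL z \<partial>lborel)))) * (indicator B (ap (N \<omega>) i) * ?W \<omega>) \<partial>M)"
  proof (rule nn_integral_cong)
    fix \<omega>
    let ?v = "ap (N \<omega>) i"
    have "(\<integral>\<^sup>+\<omega>'. indicator B ?v * (iprod (\<lambda>k. 1 - loud_prob cL (enb (N \<omega>') k - ?v)) * ?W \<omega>) \<partial>M)
      = (\<integral>\<^sup>+\<omega>'. iprod (\<lambda>k. 1 - loud_prob cL (enb (N \<omega>') k - ?v)) * (indicator B ?v * ?W \<omega>) \<partial>M)"
      by (simp only: mult_ac)
    also have "\<dots> = (\<integral>\<^sup>+\<omega>'. iprod (\<lambda>k. 1 - loud_prob cL (enb (N \<omega>') k - ?v)) \<partial>M) * (indicator B ?v * ?W \<omega>)"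
      by (rule nn_integral_multc) measurable
    also have "(\<integral>\<^sup>+\<omega>'. iprod (\<lambda>k. 1 - loud_prob cL (enb (N \<omega>') k - ?v)) \<partial>M)
      = ennreal (exp (- (lamL * (\<integral>y. loud_prob cL (y - ?v) \<partial>lborel))))"
      by (rule enb.expectation_iprod)
        (auto simp: loud_prob_nonneg loud_prob_le_1 cL intro: integrable_lborel_diff int)
    finally show "(\<integral>\<^sup>+\<omega>'. indicator B ?v * (iprod (\<lambda>k. 1 - loud_prob cL (enb (N \<omega>') k - ?v)) * ?W \<omega>) \<partial>M)
      = ennreal (exp (- (lamL * (\<integral>z. loud_prob cL z \<partial>lborel)))) * (indicator B ?v * ?W \<omega>)"
      by (simp add: integral_lborel_diff)
  qed
  also have "\<dots> = ennreal (exp (- (lamL * (\<integral>z. loud_prob cL z \<partial>lborel)))) * (\<integral>\<^sup>+\<omega>. indicator B (ap (N \<omega>) i) * ?W \<omega> \<partial>M)"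
    by (rule nn_integral_cmult) measurable
  finally show ?thesis .
qed

text \<open>Timer \<open>i\<close> is independent of the AP positions, so it becomes a parameter
  \<open>t\<close> and Mecke's formula can be used for each fixed \<open>t\<close>.\<close>

lemma expectation_timer_average:
  assumes [measurable]: "B \<in> sets borel"
  shows "(\<integral>\<^sup>+\<omega>. indicator B (ap (N \<omega>) i) * iprod (\<lambda>j. 1 - timer (N \<omega>) i * loud_prob cW (ap (N \<omega>) j - ap (N \<omega>) i)) \<partial>M)
    = (\<integral>\<^sup>+t. indicator {0..1} t * (\<integral>\<^sup>+\<omega>. indicator B (ap (N \<omega>) i) * iprod (\<lambda>j. 1 - t * loud_prob cW (ap (N \<omega>) j - ap (N \<omega>) i)) \<partial>M) \<partial>lborel)"
proof -
  define J where "J = {Timer i}"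
  define K where "K = {APs}"
  have [measurable]: "(\<lambda>\<omega>. timer (N \<omega>) i) \<in> borel_measurable (sources J)"
    "(\<lambda>\<omega>. ap (N \<omega>) j) \<in> borel_measurable (sources K)" for j
    by (auto simp: J_def K_def intro!: measurable_network)
  have "(\<integral>\<^sup>+\<omega>. indicator B (ap (N \<omega>) i) * iprod (\<lambda>j. 1 - timer (N \<omega>) i * loud_prob cW (ap (N \<omega>) j - ap (N \<omega>) i)) \<partial>M)
    = (\<integral>\<^sup>+\<omega>. \<integral>\<^sup>+\<omega>'. indicator B (ap (N \<omega>') i) * iprod (\<lambda>j. 1 - timer (N \<omega>) i * loud_prob cW (ap (N \<omega>') j - ap (N \<omega>') i)) \<partial>M \<partial>M)"
  proof (rule nn_integral_sources_diagonal[of J K])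
    show "(\<lambda>(\<omega>, \<omega>'). indicator B (ap (N \<omega>') i) * iprod (\<lambda>j. 1 - timer (N \<omega>) i * loud_prob cW (ap (N \<omega>') j - ap (N \<omega>') i)))
      \<in> borel_measurable (sources J \<Otimes>\<^sub>M sources K)"
      by measurable
  qed (auto simp: J_def K_def)
  also have "\<dots> = (\<integral>\<^sup>+t. indicator {0..1} t * (\<integral>\<^sup>+\<omega>. indicator B (ap (N \<omega>) i) * iprod (\<lambda>j. 1 - t * loud_prob cW (ap (N \<omega>) j - ap (N \<omega>) i)) \<partial>M) \<partial>lborel)"
    by (rule distributed_nn_integral[OF timer, symmetric]) measurable
  finally show ?thesis .
qed

text \<open>The eNB factor is split off first, then the timer becomes a parameter, then Mecke's
  formula is applied at each \<open>t\<close>, and the integral over \<open>t\<close> comes last.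
  The radial profile \<open>q\<close> supplies the monotonicity and continuity for Mecke's
  formula.\<close>

lemma suminf_emeasure_access:
  assumes lam: "lamW > 0" "lamL > 0"
    and ap: "homogeneous_poisson_process M lamW (\<lambda>\<omega>. ap (N \<omega>))"
    and enb: "homogeneous_poisson_process M lamL (\<lambda>\<omega>. enb (N \<omega>))"
    and intL: "integrable lborel (loud_prob cL)" and intW: "integrable lborel (loud_prob cW)"
    and q: "\<And>z. l z = q (norm z)" "continuous_on {0<..} q" "\<And>r r'. 0 < r \<Longrightarrow> r \<le> r' \<Longrightarrow> q r \<le> q r'"
    and q_nonneg: "\<And>r. 0 \<le> q r"
    and B [measurable]: "B \<in> sets borel" and fin: "emeasure lborel B < \<infinity>"
  defines "NL \<equiv> lamL * (\<integral>z. loud_prob cL z \<partial>lborel)" and "NW \<equiv> lamW * (\<integral>z. loud_prob cW z \<partial>lborel)"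
  shows "(\<Sum>i. emeasure M {\<omega> \<in> space M. ap (N \<omega>) i \<in> B \<and>
      (\<forall>k. fading_LW (N \<omega>) k i / l (enb (N \<omega>) k - ap (N \<omega>) i) \<le> cL) \<and>
      (\<forall>j. timer (N \<omega>) j < timer (N \<omega>) i \<longrightarrow> fading_W (N \<omega>) j i / l (ap (N \<omega>) j - ap (N \<omega>) i) \<le> cW)})
    = ennreal (exp (- NL) * ((1 - exp (- NW)) / NW)) * (ennreal lamW * emeasure lborel B)"
proof -
  interpret ap: poisson_points M lamW "\<lambda>\<omega>. ap (N \<omega>)"
    by unfold_locales (rule lam ap)+
  \<comment> \<open>\<open>NW\<close> must be nonzero for the division by it.
    \<open>loud_prob cW\<close> is positive off the origin, so a zero integral would make the whole
    plane a null set.\<close>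
  have "(\<integral>z. loud_prob cW z \<partial>lborel) \<noteq> 0"
  proof
    assume "(\<integral>z. loud_prob cW z \<partial>lborel) = 0"
    then have "AE z in lborel. loud_prob cW z = 0"
      using intW by (subst (asm) integral_nonneg_eq_0_iff_AE) (auto simp: loud_prob_nonneg)
    moreover have "AE z in lborel. z \<noteq> (0 :: real ^ 2)" by (rule AE_lborel_singleton)
    ultimately have "AE z in (lborel :: (real ^ 2) measure). False"
      by eventually_elim (simp add: loud_prob_def)
    then have "UNIV \<in> null_sets (lborel :: (real ^ 2) measure)"
      by (subst (asm) AE_iff_null) auto
    then show False by (simp add: null_sets_def)
  qed
  then have NW: "NW > 0"
    using lam by (simp add: NW_def less_le Bochner_Integration.integral_nonneg loud_prob_nonneg)
  let ?T = "\<lambda>t i. \<integral>\<^sup>+\<omega>. indicator B (ap (N \<omega>) i) * iprod (\<lambda>j. 1 - t * loud_prob cW (ap (N \<omega>) j - ap (N \<omega>) i)) \<partial>M"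
  \<comment> \<open>A node must be both earlier and loud to block, which scales the kernel and hence
    the exponent \<open>NW\<close> by \<open>t\<close>.\<close>
  have mecke: "(\<Sum>i. ?T t i) = ennreal lamW * (emeasure lborel B * ennreal (exp (- (NW * t))))"
    if t: "0 \<le> t" "t \<le> 1" for t
  proof -
    have le: "t * exp (- (\<mu> * cW * q r)) \<le> 1" for r
      using t \<mu> cW q_nonneg[of r] by (intro mult_le_one) auto
    have "(\<Sum>i. ?T t i) = ennreal lamW * (emeasure lborel B * ennreal (exp (- (lamW * (\<integral>z. t * loud_prob cW z \<partial>lborel)))))"
    proof (rule ap.suminf_expectation_iprod[where p = "\<lambda>r. t * exp (- (\<mu> * cW * q r))"])
      show "continuous_on {0<..} (\<lambda>r. t * exp (- (\<mu> * cW * q r)))"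
        by (intro continuous_intros q(2))
      show "t * exp (- (\<mu> * cW * q r')) \<le> t * exp (- (\<mu> * cW * q r))" if "0 < r" "r \<le> r'" for r r'
        using t \<mu> cW q(3)[OF that] by (intro mult_left_mono) auto
      show "t * loud_prob cW z = (if z = 0 then 0 else t * exp (- (\<mu> * cW * q (norm z))))" for z
        by (simp add: loud_prob_def q(1))
    qed (use t intW fin B le in auto)
    then show ?thesis by (simp add: NW_def mult_ac)
  qed
  have "(\<Sum>i. emeasure M {\<omega> \<in> space M. ap (N \<omega>) i \<in> B \<and>
      (\<forall>k. fading_LW (N \<omega>) k i / l (enb (N \<omega>) k - ap (N \<omega>) i) \<le> cL) \<and>
      (\<forall>j. timer (N \<omega>) j < timer (N \<omega>) i \<longrightarrow> fading_W (N \<omega>) j i / l (ap (N \<omega>) j - ap (N \<omega>) i) \<le> cW)})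
    = (\<Sum>i. ennreal (exp (- NL)) * (\<integral>\<^sup>+t. indicator {0..1} t * ?T t i \<partial>lborel))"
    unfolding emeasure_access[OF B] expectation_enb_factor[OF lam(2) enb intL B] expectation_timer_average[OF B] NL_def ..
  also have "\<dots> = ennreal (exp (- NL)) * (\<integral>\<^sup>+t. (\<Sum>i. indicator {0..1} t * ?T t i) \<partial>lborel)"
  proof -
    have "(\<lambda>t. indicator {0..1} t * ?T t i) \<in> borel_measurable lborel" for i
      by measurable
    then show ?thesis
      by (subst ennreal_suminf_cmult) (intro arg_cong2[where f = "(*)"] refl nn_integral_suminf[symmetric])
  qed
  also have "(\<integral>\<^sup>+t. (\<Sum>i. indicator {0..1} t * ?T t i) \<partial>lborel)
    = (\<integral>\<^sup>+t. (indicator {0..1} t * ennreal (exp (- (NW * t)))) * (ennreal lamW * emeasure lborel B) \<partial>lborel)"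
  proof (rule nn_integral_cong)
    fix t :: real
    have "(\<Sum>i. indicator {0..1} t * ?T t i) = indicator {0..1} t * (\<Sum>i. ?T t i)"
      by (rule ennreal_suminf_cmult)
    also have "\<dots> = (indicator {0..1} t * ennreal (exp (- (NW * t)))) * (ennreal lamW * emeasure lborel B)"
    proof (cases "t \<in> {0..1}")
      case True
      then show ?thesis by (simp add: mecke mult_ac)
    next
      case False
      then have "indicator {0..1} t = (0 :: ennreal)" by (rule indicator_simps(2))
      then show ?thesis by (simp only: mult_zero_left)
    qed
    finally show "(\<Sum>i. indicator {0..1} t * ?T t i)
      = (indicator {0..1} t * ennreal (exp (- (NW * t)))) * (ennreal lamW * emeasure lborel B)" .
  qed
  also have "\<dots> = ennreal ((1 - exp (- NW)) / NW) * (ennreal lamW * emeasure lborel B)"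
    by (subst nn_integral_multc) (simp_all add: nn_integral_exp_linear[OF NW])
  moreover have "ennreal (exp (- NL) * ((1 - exp (- NW)) / NW)) = ennreal (exp (- NL)) * ennreal ((1 - exp (- NW)) / NW)"
    using NW by (intro ennreal_mult) auto
  ultimately show ?thesis
    by (simp only: mult.assoc)
qed

end

section \<open>From the access indicator to the Palm probability\<close>

text \<open>The partial products are eventually constant: one false factor makes all later products
  0, and otherwise they are all 1.\<close>

lemma lim_prod_of_bool:
  "lim (\<lambda>n::nat. \<Prod>k\<in>{..<n} - D. of_bool (P k) :: real) = of_bool (\<forall>k\<in>- D. P k)"
proof (rule limI, rule tendsto_eventually)
  show "eventually (\<lambda>n. (\<Prod>k\<in>{..<n} - D. of_bool (P k)) = (of_bool (\<forall>k\<in>- D. P k) :: real)) sequentially"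
  proof (cases "\<forall>k\<in>- D. P k")
    case True
    then show ?thesis by (intro always_eventually allI) (auto intro!: prod.neutral)
  next
    case False
    then obtain k where k: "k \<notin> D" "\<not> P k" by auto
    show ?thesis
    proof (rule eventually_sequentiallyI)
      fix n assume "Suc k \<le> n"
      then have "(\<Prod>k\<in>{..<n} - D. of_bool (P k)) = (0 :: real)"
        using k by (intro prod_zero) auto
      then show "(\<Prod>k\<in>{..<n} - D. of_bool (P k)) = (of_bool (\<forall>k\<in>- D. P k) :: real)"
        using False by simp
    qed
  qed
qed

text \<open>Recentring cancels in the differences of positions. The restriction to \<open>j\<close>
  other than \<open>i\<close> disappears because no timer is less than itself.\<close>

lemma wifi_access_indicator_recentre:
  "wifi_access_indicator lamC \<alpha> \<Gamma>cs \<Gamma>ed PW PL (recentre v n) i = 1 \<longleftrightarrow>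
    (\<forall>k. fading_LW n k i / path_loss lamC \<alpha> (norm (enb n k - ap n i)) \<le> \<Gamma>ed / PL) \<and>
    (\<forall>j. timer n j < timer n i \<longrightarrow> fading_W n j i / path_loss lamC \<alpha> (norm (ap n j - ap n i)) \<le> \<Gamma>cs / PW)"
proof -
  have factor: "of_bool (a \<ge> b) + of_bool (a < b) * of_bool c = (of_bool (a < b \<longrightarrow> c) :: real)" for a b :: real and c
    by auto
  show ?thesis
    unfolding wifi_access_indicator_def factor lim_prod_of_bool
    using lim_prod_of_bool[where D = "{}"]
    by (auto simp: recentre_def)
qed

theorem lemma1:
  fixes M :: "'a measure" and N :: "'a \<Rightarrow> network"
    and lamW lamL lamC \<alpha> \<mu> PW PL \<Gamma>cs \<Gamma>ed NL NW :: real
    and B :: "(real ^ 2) set"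
  assumes "prob_space M"
    and "lamW > 0" "lamL > 0" "lamC > 0" "\<alpha> > 0" "\<mu> > 0"
    and "PW > 0" "PL > 0" "\<Gamma>cs > 0" "\<Gamma>ed > 0"
    and "homogeneous_poisson_process M lamW (\<lambda>\<omega>. ap (N \<omega>))"
    and "homogeneous_poisson_process M lamL (\<lambda>\<omega>. enb (N \<omega>))"
    and "\<And>i. distributed M lborel (\<lambda>\<omega>. timer (N \<omega>) i) (indicator {0..1})"
    and "\<And>j i. distributed M lborel (\<lambda>\<omega>. fading_W (N \<omega>) j i) (\<lambda>x. ennreal (exponential_density \<mu> x))"
    and "\<And>k i. distributed M lborel (\<lambda>\<omega>. fading_LW (N \<omega>) k i) (\<lambda>x. ennreal (exponential_density \<mu> x))"
    and "prob_space.indep_sets M (source_events M N) UNIV"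
    and "NL = lamL * (\<integral>x. exp (- \<mu> * (\<Gamma>ed / PL) * path_loss lamC \<alpha> (norm x)) \<partial>(lborel :: (real ^ 2) measure))"
    and "NW = lamW * (\<integral>x. exp (- \<mu> * (\<Gamma>cs / PW) * path_loss lamC \<alpha> (norm x)) \<partial>(lborel :: (real ^ 2) measure))"
    and "B \<in> sets borel" "0 < emeasure lborel B" "emeasure lborel B < \<infinity>"
  shows "palm_probability M lamW N B (\<lambda>N' i. wifi_access_indicator lamC \<alpha> \<Gamma>cs \<Gamma>ed PW PL N' i = 1)
           = ennreal (exp (- NL) * ((1 - exp (- NW)) / NW))"
proof -
  let ?l = "\<lambda>z :: real ^ 2. path_loss lamC \<alpha> (norm z)"
  interpret prob_space M by fact
  have pl_cont: "continuous_on {0<..} (path_loss lamC \<alpha>)"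
    unfolding path_loss_def by (intro continuous_intros) auto
  have pl_mono: "path_loss lamC \<alpha> r \<le> path_loss lamC \<alpha> r'" if "0 < r" "r \<le> r'" for r r'
    unfolding path_loss_def using that \<open>\<alpha> > 0\<close> by (intro mult_left_mono powr_mono2) auto
  have pl_nonneg: "0 \<le> path_loss lamC \<alpha> r" for r by (simp add: path_loss_def)
  \<comment> \<open>The path loss vanishes at the origin because
    \<open>0 powr \<alpha> = 0\<close>.\<close>
  interpret wifi_lte_network M N \<mu> "\<Gamma>cs / PW" "\<Gamma>ed / PL" ?l
  proof unfold_locales
    show "?l \<in> borel_measurable borel"
      unfolding path_loss_def by measurable
    show "?l z > 0" if "z \<noteq> 0" for z
      using that \<open>lamC > 0\<close> by (simp add: path_loss_def)
  qed (use assms in \<open>auto simp: path_loss_def\<close>)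
  \<comment> \<open>\<open>loud_prob c\<close> and the exponential in the definitions of
    \<open>NL\<close> and \<open>NW\<close> differ only at the origin, a null set.\<close>
  have loud: "integrable lborel (loud_prob c) \<and>
      (\<integral>z. loud_prob c z \<partial>lborel) = (\<integral>z. exp (- \<mu> * c * ?l z) \<partial>lborel)" if "c > 0" for c
  proof -
    have "AE z in lborel. loud_prob c z = exp (- \<mu> * c * ?l z)"
      using AE_lborel_singleton[of "0 :: real ^ 2"] by eventually_elim (simp add: loud_prob_def)
    moreover have "integrable lborel (\<lambda>z. exp (- \<mu> * c * ?l z))"
      using integrable_exp_minus_norm_powr[of "\<mu> * c * (4 * pi / lamC)\<^sup>2" \<alpha>] that assms
      by (simp add: path_loss_def mult.assoc)
    ultimately show ?thesis
      by (subst integrable_cong_AE[of "loud_prob c" lborel "\<lambda>z. exp (- \<mu> * c * ?l z)"])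
        (auto intro!: integral_cong_AE)
  qed
  have c: "\<Gamma>ed / PL > 0" "\<Gamma>cs / PW > 0" using assms by auto
  note B = \<open>B \<in> sets borel\<close>
  note [measurable] = B
  let ?E = "\<lambda>i. {\<omega> \<in> space M. ap (N \<omega>) i \<in> B \<and>
      (\<forall>k. fading_LW (N \<omega>) k i / ?l (enb (N \<omega>) k - ap (N \<omega>) i) \<le> \<Gamma>ed / PL) \<and>
      (\<forall>j. timer (N \<omega>) j < timer (N \<omega>) i \<longrightarrow> fading_W (N \<omega>) j i / ?l (ap (N \<omega>) j - ap (N \<omega>) i) \<le> \<Gamma>cs / PW)}"
  have "?E i \<in> events" for i by measurable
  let ?A = "\<lambda>\<omega>. {i. ap (N \<omega>) i \<in> B \<and>
      wifi_access_indicator lamC \<alpha> \<Gamma>cs \<Gamma>ed PW PL (recentre (ap (N \<omega>) i) (N \<omega>)) i = 1}"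
  \<comment> \<open>Counting APs by label turns the expected number into the sum of the access
    probabilities of the single labels.\<close>
  have "(\<integral>\<^sup>+\<omega>. emeasure (count_space UNIV) (?A \<omega>) \<partial>M) = (\<integral>\<^sup>+\<omega>. (\<Sum>i. indicator (?E i) \<omega>) \<partial>M)"
  proof (rule nn_integral_cong)
    fix \<omega> assume "\<omega> \<in> space M"
    have "emeasure (count_space UNIV) (?A \<omega>) = (\<integral>\<^sup>+i. indicator (?A \<omega>) i \<partial>count_space UNIV)"
      by simp
    also have "\<dots> = (\<Sum>i. indicator (?A \<omega>) i)" by (rule nn_integral_count_space_nat)
    also have "\<dots> = (\<Sum>i. indicator (?E i) \<omega>)"
      using \<open>\<omega> \<in> space M\<close> by (intro suminf_cong) (simp add: indicator_def wifi_access_indicator_recentre)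
    finally show "emeasure (count_space UNIV) (?A \<omega>) = (\<Sum>i. indicator (?E i) \<omega>)" .
  qed
  also have "\<dots> = (\<Sum>i. emeasure M (?E i))"
    by (subst nn_integral_suminf) (use \<open>\<And>i. ?E i \<in> events\<close> in auto)
  also have "\<dots> = ennreal (exp (- NL) * ((1 - exp (- NW)) / NW)) * (ennreal lamW * emeasure lborel B)"
    using suminf_emeasure_access[of lamW lamL "path_loss lamC \<alpha>", OF assms(2,3,11,12) _ _ refl pl_cont pl_mono pl_nonneg B]
      loud[OF c(1)] loud[OF c(2)] assms by simp
  \<comment> \<open>Cancelling \<open>lamW\<close> times the area of \<open>B\<close> in
    \<open>ennreal\<close> is sound because this number is positive and finite.\<close>
  finally show ?thesis
    using assms by (simp add: palm_probability_def mult_divide_eq_ennreal ennreal_mult_eq_top_iff)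
qed

end
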